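(* Let $0<\alpha<1$ and let $r \ge 2^{1/\alpha^{20}}$ be an integer. Then the number of $\alpha$-equiangular lines in $\mathbb{R}^r$ is at most $$\left\lfloor \left(1+\frac{2\alpha}{1-\alpha}\right)(r-1)\right\rfloor.$$
   Context: A family of lines through the origin in $\mathbb{R}^r$ is $\alpha$-equiangular if the acute angle between any two distinct lines equals $\arccos\alpha$ (equivalently, unit vectors chosen on the lines have pairwise inner products $\pm\alpha$). *)

theory Defs
  imports "HOL-Analysis.Analysis"
begin

definition origin_line :: "'a::euclidean_space set \<Rightarrow> bool" where
  "origin_line L \<longleftrightarrow> subspace L \<and> dim L = 1"

definition vec_angle :: "'a::real_inner \<Rightarrow> 'a \<Rightarrow> real" where
  "vec_angle u v = arccos ((u \<bullet> v) / (norm u * norm v))"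

(* Nonzero vectors spanning two given lines make only two angles, t and pi - t;
   the infimum selects the smaller one, which lies in [0, pi/2]. *)
definition line_angle :: "'a::euclidean_space set \<Rightarrow> 'a set \<Rightarrow> real" where
  "line_angle L M = Inf {vec_angle u v |u v. u \<in> L \<and> v \<in> M \<and> u \<noteq> 0 \<and> v \<noteq> 0}"

definition equiangular :: "real \<Rightarrow> 'a::euclidean_space set set \<Rightarrow> bool" where
  "equiangular \<alpha> F \<longleftrightarrow>
     (\<forall>L\<in>F. origin_line L) \<and>
     (\<forall>L\<in>F. \<forall>M\<in>F. L \<noteq> M \<longrightarrow> line_angle L M = arccos \<alpha>)"

end

theory Submission
  imports Defs
begin

text \<open>
  Choose unit vectors on the \<open>n\<close> lines and let \<open>A\<close> be the adjacency matrix of the graph of negative inner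
  products. With \<open>lam = (1 - \<alpha>) / (2 * \<alpha>)\<close>, the Gram matrix is \<open>2 * \<alpha>\<close> times \<open>lam I - A + J / 2\<close>, so that
  \<open>A \<le> lam\<close> on vectors orthogonal to the constants, and the linear relations between the unit vectors (with
  coefficient sum zero) are eigenvectors of \<open>A\<close> with eigenvalue \<open>lam\<close>. One has to show that the eigenspace has
  dimension at most about \<open>n / (lam + 1)\<close>. If \<open>p\<^sub>v\<close> (\<open>mass\<close>) are the diagonal entries of the projection
  to the eigenspace and \<open>d\<^sub>v\<close> the degrees, then Cauchy-Schwarz gives \<open>p\<^sub>v \<le> d\<^sub>v / (d\<^sub>v + lam\<^sup>2)\<close>. When \<open>A \<le> lam\<close>, the
  average degree is at most \<open>lam\<close> and concavity finishes the proof.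

  Otherwise, after switching to a graph of bounded degree (Ramsey), all but a bounded number of the vertices
  have a large neighbourhood on which \<open>A \<le> lam\<close>, because two distant violations would contradict the
  inequality for vectors orthogonal to the constants. Let \<open>L = (1 + A / lam) / 2\<close> (\<open>lazy\<close>; \<open>ret m v\<close> is
  the column \<open>v\<close> of \<open>L\<^sup>m\<close>) and \<open>q\<^sub>v = (L\<^sup>m)\<^sub>v\<^sub>v \<ge> p\<^sub>v\<close>.
  A Perron-Frobenius argument shows that \<open>L\<^sup>m\<close> is almost of rank one near such a vertex \<open>v\<close>:
  \<open>((L\<^sup>m)\<^sub>u\<^sub>v)\<^sup>2\<close> is almost \<open>q\<^sub>u q\<^sub>v\<close> if \<open>u\<close> has distance at most 2 from \<open>v\<close>. Since
  \<open>\<Sum>\<^sub>u ((L\<^sup>m)\<^sub>u\<^sub>v)\<^sup>2 \<le> q\<^sub>v\<close>, the sum of \<open>q\<^sub>u\<close> over the ball of radius 2 is essentially at most 1, whence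
  \<open>\<Sum>\<^sub>v (d\<^sub>v + 2) p\<^sub>v\<close> is essentially at most \<open>n\<close>. Together with the bound on \<open>p\<^sub>v\<close> this gives dimension about
  \<open>n / (lam + 3 / 2)\<close>, which leaves room for all the errors.
\<close>

subsection \<open>Orthonormal families and Ramsey numbers\<close>

text \<open>Vectors are total functions on the vertex type and only their values on \<open>V\<close>
  count, so functions can be combined and restricted without coercions.\<close>

definition ip :: "'a set \<Rightarrow> ('a \<Rightarrow> real) \<Rightarrow> ('a \<Rightarrow> real) \<Rightarrow> real" where
  "ip V y z = (\<Sum>v\<in>V. y v * z v)"

definition orthonormal_on :: "'a set \<Rightarrow> nat \<Rightarrow> (nat \<Rightarrow> 'a \<Rightarrow> real) \<Rightarrow> bool" where
  "orthonormal_on V k f \<longleftrightarrow> (\<forall>i<k. \<forall>j<k. ip V (f i) (f j) = (if i = j then 1 else 0))"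

lemma ip_commute: "ip V y z = ip V z y"
  by (simp add: ip_def mult.commute)

lemma ip_lin_left: "ip V (\<lambda>v. a * y v + b * z v) w = a * ip V y w + b * ip V z w"
  by (simp add: ip_def sum_distrib_left sum.distrib algebra_simps)

lemma ip_lin_right: "ip V w (\<lambda>v. a * y v + b * z v) = a * ip V w y + b * ip V w z"
  by (simp add: ip_def sum_distrib_left sum.distrib algebra_simps)

lemma ip_self_nonneg [simp]: "ip V y y \<ge> 0"
  by (simp add: ip_def sum_nonneg)

lemma ip_sum_left: "ip V (\<lambda>v. \<Sum>i\<in>I. g i v) w = (\<Sum>i\<in>I. ip V (g i) w)"
  unfolding ip_def sum_distrib_right by (rule sum.swap)

lemma ip_scale_left: "ip V (\<lambda>v. a * y v) w = a * ip V y w"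
  by (simp add: ip_def sum_distrib_left algebra_simps)

lemma ip_scale_right: "ip V w (\<lambda>v. a * y v) = a * ip V w y"
  by (simp add: ip_def sum_distrib_left algebra_simps)

lemma ip_diff_left: "ip V (\<lambda>v. y v - z v) w = ip V y w - ip V z w"
  by (simp add: ip_def sum_subtractf algebra_simps)

lemma ip_self_pos: "finite V \<Longrightarrow> v \<in> V \<Longrightarrow> y v \<noteq> 0 \<Longrightarrow> ip V y y > 0"
  unfolding ip_def by (rule sum_pos2) (auto simp: zero_less_mult_iff linorder_neq_iff)

lemma ip_cong: "(\<And>v. v \<in> V \<Longrightarrow> y v = y' v) \<Longrightarrow> (\<And>v. v \<in> V \<Longrightarrow> z v = z' v) \<Longrightarrow> ip V y z = ip V y' z'"
  by (simp add: ip_def)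

text \<open>Fewer equations than unknowns: Gaussian elimination, one equation and one unknown at a
  time.\<close>

lemma homogeneous_solution:
  fixes a :: "'j \<Rightarrow> 'a \<Rightarrow> real"
  assumes "finite J" "finite V" "card J < card V"
  shows "\<exists>z. (\<exists>v\<in>V. z v \<noteq> 0) \<and> (\<forall>j\<in>J. ip V (a j) z = 0)"
  using assms
proof (induction J arbitrary: V a rule: finite_induct)
  case empty
  then have "V \<noteq> {}" by auto
  then show ?case by (intro exI[of _ "\<lambda>_. 1"]) auto
next
  case (insert j J)
  show ?case
  proof (cases "\<forall>v\<in>V. a j v = 0")
    case True
    obtain z where z: "\<exists>v\<in>V. z v \<noteq> 0" "\<forall>i\<in>J. ip V (a i) z = 0"
      using insert.IH[of V a] insert.prems insert.hyps by auto
    moreover have "ip V (a j) z = 0" using True by (simp add: ip_def)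
    ultimately show ?thesis by auto
  next
    case False
    then obtain v0 where v0: "v0 \<in> V" "a j v0 \<noteq> 0" by auto
    define W where "W = V - {v0}"
    \<comment> \<open>Equation \<open>i\<close> after the unknown \<open>v0\<close> has been
      eliminated with the help of equation \<open>j\<close>; \<open>c\<close> below is the value of
      \<open>v0\<close> that equation \<open>j\<close> then forces.\<close>
    define b where "b i v = a i v - a i v0 / a j v0 * a j v" for i v
    have W: "finite W" "card J < card W" "v0 \<notin> W" "V = insert v0 W"
      using insert.prems insert.hyps v0 by (auto simp: W_def)
    obtain z where z: "\<exists>v\<in>W. z v \<noteq> 0" "\<forall>i\<in>J. ip W (b i) z = 0"
      using insert.IH[of W b] W by auto
    define c where "c = - ip W (a j) z / a j v0"
    have ip_split: "ip V g (z(v0 := c)) = g v0 * c + ip W g z" for g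
    proof -
      have "(\<Sum>v\<in>W. g v * (z(v0 := c)) v) = (\<Sum>v\<in>W. g v * z v)"
        using W(3) by (intro sum.cong) auto
      then show ?thesis unfolding ip_def using W by simp
    qed
    have "ip V (a j) (z(v0 := c)) = 0"
      unfolding ip_split using v0 by (simp add: c_def)
    moreover have "ip V (a i) (z(v0 := c)) = 0" if "i \<in> J" for i
    proof -
      have "ip W (b i) z = ip W (a i) z - a i v0 / a j v0 * ip W (a j) z"
        unfolding b_def by (simp only: ip_diff_left ip_scale_left)
      then show ?thesis unfolding ip_split using z(2) that by (simp add: c_def)
    qed
    moreover have "\<exists>v\<in>V. (z(v0 := c)) v \<noteq> 0" using z(1) W by auto
    ultimately show ?thesis by blast
  qed
qed

lemma orthonormal_on_extend:
  assumes f: "orthonormal_on V k f" and g: "ip V g g > 0" "\<And>i. i < k \<Longrightarrow> ip V (f i) g = 0"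
  shows "orthonormal_on V (Suc k) (f(k := (\<lambda>v. inverse (sqrt (ip V g g)) * g v)))"
proof -
  let ?s = "inverse (sqrt (ip V g g))"
  have "?s * (?s * ip V g g) = 1"
    using g(1) by (simp add: field_simps)
  moreover have "ip V g (f i) = 0" if "i < k" for i
    using g(2)[OF that] by (subst ip_commute)
  ultimately show ?thesis
    using f g(2) unfolding orthonormal_on_def
    by (auto simp: less_Suc_eq ip_scale_left ip_scale_right)
qed

text \<open>Greedy construction: the next vector solves the given equations together with
  orthogonality to the vectors already chosen. The sum type merges both kinds of conditions into one
  system.\<close>

lemma orthonormal_solutions:
  fixes a :: "'j \<Rightarrow> 'a \<Rightarrow> real"
  assumes "finite J" "finite V" "k + card J \<le> card V"
  shows "\<exists>f. orthonormal_on V k f \<and> (\<forall>i<k. \<forall>j\<in>J. ip V (a j) (f i) = 0)"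
  using assms(3)
proof (induction k)
  case 0
  show ?case by (simp add: orthonormal_on_def)
next
  case (Suc k)
  then obtain f where f: "orthonormal_on V k f" "\<forall>i<k. \<forall>j\<in>J. ip V (a j) (f i) = 0"
    by auto
  have "card (J <+> {..<k}) < card V"
    using Suc.prems assms by (simp add: card_Plus)
  then obtain z where z: "\<exists>v\<in>V. z v \<noteq> 0"
    "\<forall>j\<in>J <+> {..<k}. ip V (case_sum a f j) z = 0"
    using homogeneous_solution[of "J <+> {..<k}" V "case_sum a f"] assms by auto
  have zf: "ip V (f i) z = 0" if "i < k" for i
    using z(2) that by (force dest: bspec[where x = "Inr i"])
  have za: "ip V (a j) z = 0" if "j \<in> J" for j
    using z(2) that by (force dest: bspec[where x = "Inl j"])
  have pos: "ip V z z > 0" using z(1) ip_self_pos assms(2) by metis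
  show ?case
    using orthonormal_on_extend[OF f(1) pos zf] f(2) za
    by (intro exI conjI) (auto simp: less_Suc_eq ip_scale_right)
qed

text \<open>Here \<open>h\<close> is the projection of \<open>g\<close> to the span of the family;
  the claim is that the square norm of \<open>g - h\<close> is nonnegative.\<close>

lemma bessel:
  assumes f: "orthonormal_on V k f"
  shows "(\<Sum>i<k. (ip V (f i) g)\<^sup>2) \<le> ip V g g"
proof -
  define c where "c i = ip V (f i) g" for i
  define h where "h v = (\<Sum>i<k. c i * f i v)" for v
  have hz: "ip V h z = (\<Sum>i<k. c i * ip V (f i) z)" for z
    unfolding h_def by (simp add: ip_sum_left ip_scale_left)
  have "ip V (f i) h = c i" if "i < k" for i
  proof -
    have "ip V (f i) h = (\<Sum>j<k. c j * (if j = i then 1 else 0))"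
      using f that by (subst ip_commute) (auto simp: hz orthonormal_on_def intro!: sum.cong)
    also have "\<dots> = (\<Sum>j<k. if j = i then c j else 0)"
      by (intro sum.cong) auto
    finally show ?thesis using that by simp
  qed
  then have hh: "ip V h h = (\<Sum>i<k. (c i)\<^sup>2)"
    by (simp add: hz power2_eq_square)
  have hg: "ip V h g = (\<Sum>i<k. (c i)\<^sup>2)"
    by (simp add: hz c_def power2_eq_square)
  have "0 \<le> ip V (\<lambda>v. 1 * g v + (-1) * h v) (\<lambda>v. 1 * g v + (-1) * h v)" by simp
  also have "\<dots> = ip V g g - 2 * ip V h g + ip V h h"
    unfolding ip_lin_left ip_lin_right by (simp add: ip_commute)
  finally show ?thesis by (simp add: hh hg c_def)
qed

text \<open>The crude bound makes the induction short: among the remaining vertices, one of the two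
  colour neighbourhoods of \<open>v\<close> contains at least half of the required
  \<open>2 ^ (s + t)\<close>, which is what the smaller instance needs.\<close>

lemma ramsey_two_colour:
  fixes R :: "'a \<Rightarrow> 'a \<Rightarrow> bool"
  assumes sym: "\<And>u v. R u v \<Longrightarrow> R v u"
  shows "finite V \<Longrightarrow> card V \<ge> 2 ^ (s + t) \<Longrightarrow>
    (\<exists>C\<subseteq>V. card C = s \<and> pairwise R C) \<or> (\<exists>C\<subseteq>V. card C = t \<and> pairwise (\<lambda>u v. \<not> R u v) C)"
proof (induction "s + t" arbitrary: s t V)
  case 0
  then show ?case by (metis add_is_0 card.empty empty_subsetI pairwise_empty)
next
  case (Suc k)
  show ?case
  proof (cases "s = 0 \<or> t = 0")
    case True
    then show ?thesis by (metis card.empty empty_subsetI pairwise_empty)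
  next
    case False
    then obtain s' t' where st: "s = Suc s'" "t = Suc t'" by (metis not0_implies_Suc)
    have "V \<noteq> {}" using Suc.prems by auto
    then obtain v where v: "v \<in> V" by blast
    define P where "P = {u \<in> V - {v}. R v u}"
    define Q where "Q = {u \<in> V - {v}. \<not> R v u}"
    have "card V = card P + card Q + 1"
    proof -
      have "V = insert v (P \<union> Q)" using v by (auto simp: P_def Q_def)
      moreover have "v \<notin> P \<union> Q" "P \<inter> Q = {}" "finite P" "finite Q"
        using Suc.prems by (auto simp: P_def Q_def)
      ultimately show ?thesis by (simp add: card_Un_disjoint)
    qed
    moreover have "(2::nat) ^ (s + t) = 2 * 2 ^ k" "(2::nat) ^ (s' + t) = 2 ^ k"
      "(2::nat) ^ (s + t') = 2 ^ k" "s' + t = k" "s + t' = k"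
      using Suc.hyps(2) st by (auto simp flip: power_Suc)
    ultimately have "card P \<ge> 2 ^ (s' + t) \<or> card Q \<ge> 2 ^ (s + t')"
      using Suc.prems(2) by linarith
    then show ?thesis
    proof
      assume c: "card P \<ge> 2 ^ (s' + t)"
      have "finite P" using Suc.prems by (simp add: P_def)
      from Suc.hyps(1)[OF _ this c] \<open>s' + t = k\<close>
      consider C where "C \<subseteq> P" "card C = s'" "pairwise R C"
        | C where "C \<subseteq> P" "card C = t" "pairwise (\<lambda>u v. \<not> R u v) C" by blast
      then show ?thesis
      proof cases
        case 1
        have PC: "C \<subseteq> V" "v \<notin> C" "\<forall>u\<in>C. R v u \<and> R u v"
          using 1 sym by (fastforce simp: P_def)+
        from 1 have "insert v C \<subseteq> V" "card (insert v C) = s" "pairwise R (insert v C)"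
          using v st \<open>finite P\<close> finite_subset[of C P] PC
          by (auto simp: pairwise_insert card_insert_if)
        then show ?thesis by blast
      next
        case 2
        moreover have "C \<subseteq> V" using 2 by (auto simp: P_def)
        ultimately show ?thesis by blast
      qed
    next
      assume c: "card Q \<ge> 2 ^ (s + t')"
      have "finite Q" using Suc.prems by (simp add: Q_def)
      from Suc.hyps(1)[OF _ this c] \<open>s + t' = k\<close>
      consider C where "C \<subseteq> Q" "card C = s" "pairwise R C"
        | C where "C \<subseteq> Q" "card C = t'" "pairwise (\<lambda>u v. \<not> R u v) C" by blast
      then show ?thesis
      proof cases
        case 1
        moreover have "C \<subseteq> V" using 1 by (auto simp: Q_def)
        ultimately show ?thesis by blast
      next
        case 2
        have QC: "C \<subseteq> V" "v \<notin> C" "\<forall>u\<in>C. \<not> R v u \<and> \<not> R u v"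
          using 2 sym by (fastforce simp: Q_def)+
        from 2 have "insert v C \<subseteq> V" "card (insert v C) = t"
          "pairwise (\<lambda>u v. \<not> R u v) (insert v C)"
          using v st \<open>finite Q\<close> finite_subset[of C Q] QC
          by (auto simp: pairwise_insert card_insert_if)
        then show ?thesis by blast
      qed
    qed
  qed
qed

subsection \<open>Graphs and the eigenvalue bound\<close>

text \<open>The decrements of a convex sequence do not increase, so each earlier one is at least the
  last one. Applied to moments, this bounds the last decrement by a value in the middle of the
  sequence divided by the number of steps.\<close>

lemma convex_sequence_decay:
  fixes a :: "nat \<Rightarrow> real"
  assumes "\<And>j. j < N \<Longrightarrow> 0 \<le> a j - 2 * a (Suc j) + a (Suc (Suc j))" and "i \<le> N"
  shows "a N - a (Suc N) \<le> a (N - i) - a (Suc (N - i)) \<and> a N + real i * (a N - a (Suc N)) \<le> a (N - i)"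
  using assms(2)
proof (induction i)
  case (Suc i)
  have eq: "Suc (N - Suc i) = N - i" using Suc.prems by simp
  have "0 \<le> a (N - Suc i) - 2 * a (N - i) + a (Suc (N - i))"
    using assms(1)[of "N - Suc i"] Suc.prems by (simp add: eq)
  then show ?case using Suc by (simp add: eq algebra_simps)
qed simp

definition supported :: "'a set \<Rightarrow> ('a \<Rightarrow> real) \<Rightarrow> bool" where
  "supported W y \<longleftrightarrow> (\<forall>w. w \<notin> W \<longrightarrow> y w = 0)"

lemma supported_mono: "supported W y \<Longrightarrow> W \<subseteq> W' \<Longrightarrow> supported W' y"
  by (auto simp: supported_def)

lemma ip_indicator:
  assumes "finite V" "v \<in> V"
  shows "ip V (indicator {v}) y = y v" "ip V y (indicator {v}) = y v"
proof -
  show "ip V (indicator {v}) y = y v"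
    unfolding ip_def using assms by (subst sum.remove[of _ v]) (auto simp: indicator_def)
  then show "ip V y (indicator {v}) = y v"
    by (subst ip_commute)
qed

definition absf :: "('a \<Rightarrow> real) \<Rightarrow> 'a \<Rightarrow> real" where "absf y v = \<bar>y v\<bar>"

locale weighted_graph =
  fixes V :: "'a set" and E :: "'a \<Rightarrow> 'a \<Rightarrow> bool" and lam :: real
  assumes finite_V: "finite V"
    and E_in_V: "E u v \<Longrightarrow> u \<in> V"
    and E_sym: "E u v \<Longrightarrow> E v u"
    and E_irrefl: "\<not> E v v"
    and lam_pos: "lam > 0"
begin

definition nb :: "'a \<Rightarrow> 'a set" where "nb v = {u. E v u}"

definition adj :: "('a \<Rightarrow> real) \<Rightarrow> 'a \<Rightarrow> real" where "adj y v = (\<Sum>u\<in>nb v. y u)"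

lemma nb_subset: "nb v \<subseteq> V"
  using E_in_V E_sym by (auto simp: nb_def)

lemma finite_nb [simp]: "finite (nb v)"
  using nb_subset finite_V finite_subset by blast

lemma adj_eq: "adj y v = (\<Sum>u\<in>V. of_bool (E v u) * y u)"
proof -
  have "nb v = {u\<in>V. E v u}" using nb_subset by (auto simp: nb_def)
  then have "adj y v = (\<Sum>u\<in>V. if E v u then y u else 0)"
    by (simp add: adj_def sum.inter_filter finite_V)
  also have "\<dots> = (\<Sum>u\<in>V. of_bool (E v u) * y u)"
    by (rule sum.cong) auto
  finally show ?thesis .
qed

lemma ip_adj: "ip V y (adj z) = (\<Sum>v\<in>V. \<Sum>u\<in>V. of_bool (E v u) * (y v * z u))"
  unfolding ip_def adj_eq sum_distrib_left by (simp add: algebra_simps)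

lemma E_commute: "E u v \<longleftrightarrow> E v u"
  using E_sym by blast

lemma ip_adj_commute: "ip V y (adj z) = ip V (adj y) z"
  unfolding ip_commute[of V "adj y" z] ip_adj
  by (subst sum.swap) (simp add: E_commute mult.commute)

lemma adj_lin: "adj (\<lambda>w. a * y w + b * z w) v = a * adj y v + b * adj z v"
  by (simp add: adj_def sum.distrib sum_distrib_left)

lemma adj_sum: "adj (\<lambda>w. \<Sum>i\<in>I. c i * g i w) v = (\<Sum>i\<in>I. c i * adj (g i) v)"
  unfolding adj_def sum_distrib_left by (rule sum.swap)

text \<open>The adjacency matrix has nonnegative entries. Together with \<open>ip_abs\<close> this
  is the Perron-Frobenius input: taking absolute values keeps the norm and does not lower the
  form.\<close>

lemma ip_adj_abs: "\<bar>ip V y (adj y)\<bar> \<le> ip V (absf y) (adj (absf y))"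
  unfolding ip_adj
  by (intro order.trans[OF sum_abs] sum_mono) (simp add: absf_def abs_mult)

lemma ip_abs: "ip V (absf y) (absf y) = ip V y y"
  by (simp add: ip_def absf_def)

section \<open>Eigenvectors for \<open>lam\<close> and their mass at a vertex\<close>

definition eigenfamily :: "nat \<Rightarrow> (nat \<Rightarrow> 'a \<Rightarrow> real) \<Rightarrow> bool" where
  "eigenfamily k f \<longleftrightarrow> orthonormal_on V k f \<and> (\<forall>i<k. \<forall>v\<in>V. adj (f i) v = lam * f i v)"

definition mass :: "nat \<Rightarrow> (nat \<Rightarrow> 'a \<Rightarrow> real) \<Rightarrow> 'a \<Rightarrow> real" where
  "mass k f v = (\<Sum>i<k. (f i v)\<^sup>2)"

lemma mass_nonneg: "mass k f v \<ge> 0"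
  by (simp add: mass_def sum_nonneg)

lemma sum_mass:
  assumes "eigenfamily k f"
  shows "(\<Sum>v\<in>V. mass k f v) = real k"
proof -
  have "(\<Sum>v\<in>V. mass k f v) = (\<Sum>i<k. ip V (f i) (f i))"
    unfolding mass_def ip_def power2_eq_square by (rule sum.swap)
  also have "\<dots> = (\<Sum>i<k. 1)"
    using assms by (intro sum.cong) (auto simp: eigenfamily_def orthonormal_on_def)
  finally show ?thesis by simp
qed

text \<open>The column \<open>P\<close> of the projection to the span of \<open>f\<close> is itself
  an eigenvector with \<open>P v = ip V P P\<close>. Comparing its entries at \<open>v\<close> and
  at the neighbours of \<open>v\<close> with its norm gives both bounds.\<close>

lemma mass_bounds:
  assumes f: "eigenfamily k f" and v: "v \<in> V"
  shows "mass k f v \<le> 1" "mass k f v * (card (nb v) + lam\<^sup>2) \<le> card (nb v)"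
proof -
  let ?p = "mass k f v" let ?d = "real (card (nb v))"
  define P where "P u = (\<Sum>i<k. f i v * f i u)" for u
  have Pv: "P v = ?p" by (simp add: P_def mass_def power2_eq_square)
  have PP: "ip V P P = ?p"
  proof -
    have *: "ip V (f i) P = f i v" if "i < k" for i
    proof -
      have "ip V (f i) P = (\<Sum>j<k. f j v * ip V (f j) (f i))"
        unfolding P_def by (subst ip_commute) (simp add: ip_sum_left ip_scale_left)
      also have "\<dots> = (\<Sum>j<k. if j = i then f j v else 0)"
        using f that by (intro sum.cong) (auto simp: eigenfamily_def orthonormal_on_def)
      finally show ?thesis using that by simp
    qed
    have "ip V P P = (\<Sum>i<k. f i v * ip V (f i) P)"
      unfolding P_def by (simp add: ip_sum_left ip_scale_left)
    then show ?thesis using * by (simp add: mass_def power2_eq_square)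
  qed
  have "adj P v = (\<Sum>i<k. f i v * adj (f i) v)"
    unfolding P_def by (rule adj_sum)
  also have "\<dots> = lam * ?p"
    using f v unfolding mass_def sum_distrib_left
    by (intro sum.cong) (auto simp: eigenfamily_def power2_eq_square)
  finally have adjP: "adj P v = lam * ?p" .
  have "v \<notin> nb v" by (simp add: nb_def E_irrefl)
  then have "(P v)\<^sup>2 + (\<Sum>u\<in>nb v. (P u)\<^sup>2) = (\<Sum>u\<in>insert v (nb v). (P u)\<^sup>2)"
    by simp
  also have "\<dots> \<le> ip V P P"
    unfolding ip_def power2_eq_square
    using v nb_subset finite_V by (intro sum_mono2) auto
  finally have le: "?p\<^sup>2 + (\<Sum>u\<in>nb v. (P u)\<^sup>2) \<le> ?p" by (simp add: PP Pv)
  have "0 \<le> (\<Sum>u\<in>nb v. (P u)\<^sup>2)" by (simp add: sum_nonneg)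
  with le have "?p * ?p \<le> ?p * 1" by (simp add: power2_eq_square)
  then show "?p \<le> 1"
    using mass_nonneg[of k f v] by (cases "?p = 0") (auto simp: mult_le_cancel_left)
  \<comment> \<open>Cauchy-Schwarz over the neighbours of \<open>v\<close>, whose entries in
    \<open>P\<close> add up to \<open>lam * ?p\<close>.\<close>
  have "(lam * ?p)\<^sup>2 \<le> ?d * (\<Sum>u\<in>nb v. (P u)\<^sup>2)"
    using sum_squared_le_sum_of_squares[of P "nb v"] by (simp add: adj_def mult.commute flip: adjP)
  also have "\<dots> \<le> ?d * (?p - ?p\<^sup>2)"
    using le by (intro mult_left_mono) auto
  finally have "?p * (?p * (?d + lam\<^sup>2)) \<le> ?p * ?d"
    by (simp add: power2_eq_square algebra_simps)
  then show "?p * (?d + lam\<^sup>2) \<le> ?d"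
    using mass_nonneg[of k f v] by (cases "?p = 0") (auto simp: mult_le_cancel_left)
qed

text \<open>The compression of \<open>lam I - A\<close> to \<open>W\<close> is positive
  semidefinite; \<open>form_le UNIV\<close> is the global statement
  \<open>A \<le> lam\<close>.\<close>

definition form_le :: "'a set \<Rightarrow> bool" where
  "form_le W \<longleftrightarrow> (\<forall>y. supported W y \<longrightarrow> ip V y (adj y) \<le> lam * ip V y y)"

lemma eigenfamily_bound:
  assumes f: "eigenfamily k f" and le: "form_le UNIV"
  shows "real k * (1 + lam) \<le> card V"
proof -
  \<comment> \<open>Testing the form on the constant vector bounds the average degree by
    \<open>lam\<close>.\<close>
  have "ip V (\<lambda>_. 1) (adj (\<lambda>_. 1)) \<le> lam * ip V (\<lambda>_. 1) (\<lambda>_. 1)"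
    using le by (simp add: form_le_def supported_def)
  then have deg: "(\<Sum>v\<in>V. real (card (nb v))) \<le> lam * card V"
    by (simp add: ip_def adj_def)
  have "mass k f v * (1 + lam)\<^sup>2 \<le> 1 + real (card (nb v))" if v: "v \<in> V" for v
  proof -
    define d p where "d = real (card (nb v))" and "p = mass k f v"
    have pd: "p * (d + lam\<^sup>2) \<le> d" using mass_bounds(2)[OF f v] by (simp add: p_def d_def)
    have pos: "d + lam\<^sup>2 > 0" using lam_pos by (simp add: d_def add_nonneg_pos)
    have "p * (d + lam\<^sup>2) * (1 + lam)\<^sup>2 \<le> d * (1 + lam)\<^sup>2"
      using pd by (intro mult_right_mono) auto
    \<comment> \<open>The concave bound \<open>d / (d + lam\<^sup>2)\<close> lies below its tangent
      at \<open>d = lam\<close>; the gap is governed by \<open>(d - lam)\<^sup>2\<close>.\<close>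
    also have "\<dots> \<le> d * (1 + lam)\<^sup>2 + (d - lam)\<^sup>2" by simp
    also have "\<dots> = (1 + d) * (d + lam\<^sup>2)" by (simp add: power2_eq_square algebra_simps)
    finally have "(p * (1 + lam)\<^sup>2) * (d + lam\<^sup>2) \<le> (1 + d) * (d + lam\<^sup>2)"
      by (simp add: mult_ac)
    then show ?thesis using pos by (simp add: p_def d_def mult_le_cancel_right)
  qed
  then have "(\<Sum>v\<in>V. mass k f v * (1 + lam)\<^sup>2) \<le> (\<Sum>v\<in>V. 1 + real (card (nb v)))"
    by (rule sum_mono)
  then have "real k * (1 + lam)\<^sup>2 \<le> card V + lam * card V"
    using deg sum_mass[OF f] by (simp add: sum.distrib flip: sum_distrib_right)
  then have "(real k * (1 + lam)) * (1 + lam) \<le> card V * (1 + lam)"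
    by (simp add: power2_eq_square algebra_simps)
  then show ?thesis using lam_pos by (simp add: mult_le_cancel_right)
qed

section \<open>Balls and powers of the lazy operator\<close>

primrec nbhd :: "'a \<Rightarrow> nat \<Rightarrow> 'a set" where
  "nbhd v 0 = {v}"
| "nbhd v (Suc k) = nbhd v k \<union> (\<Union>u\<in>nbhd v k. nb u)"

lemma nbhd_mono: "i \<le> j \<Longrightarrow> nbhd v i \<subseteq> nbhd v j"
  by (rule lift_Suc_mono_le[of "nbhd v"]) auto

lemma nbhd_trans: "u \<in> nbhd v i \<Longrightarrow> w \<in> nbhd u j \<Longrightarrow> w \<in> nbhd v (i + j)"
  by (induction j arbitrary: w) auto

lemma nbhd_sym: "u \<in> nbhd v k \<Longrightarrow> v \<in> nbhd u k"
proof (induction k arbitrary: u)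
  case (Suc k)
  show ?case
  proof (cases "u \<in> nbhd v k")
    case False
    then obtain t where "t \<in> nbhd v k" "E t u" using Suc.prems by (auto simp: nb_def)
    then have "v \<in> nbhd t k" "t \<in> nbhd u 1" using Suc.IH E_sym by (auto simp: nb_def)
    then show ?thesis using nbhd_trans[of t u 1 v k] by simp
  qed (use Suc.IH in auto)
qed auto

lemma nbhd_subset: "v \<in> V \<Longrightarrow> nbhd v k \<subseteq> V"
  by (induction k) (use nb_subset in auto)

lemma card_nbhd_le:
  assumes "\<And>u. u \<in> V \<Longrightarrow> card (nb u) \<le> \<Delta>" "v \<in> V"
  shows "card (nbhd v k) \<le> (\<Delta> + 1) ^ k"
proof (induction k)
  case (Suc k)
  have fin: "finite (nbhd v k)" using nbhd_subset[OF assms(2)] finite_V finite_subset by blast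
  have "card (nbhd v (Suc k)) \<le> card (nbhd v k) + card (\<Union>u\<in>nbhd v k. nb u)"
    by (simp add: card_Un_le)
  also have "card (\<Union>u\<in>nbhd v k. nb u) \<le> (\<Sum>u\<in>nbhd v k. card (nb u))"
    using fin by (rule card_UN_le)
  also have "\<dots> \<le> (\<Sum>u\<in>nbhd v k. \<Delta>)"
    using assms nbhd_subset[OF assms(2), of k] by (intro sum_mono) auto
  finally have "card (nbhd v (Suc k)) \<le> (\<Delta> + 1) * card (nbhd v k)" by (simp add: mult.commute)
  also have "\<dots> \<le> (\<Delta> + 1) * (\<Delta> + 1) ^ k" using Suc.IH by (intro mult_left_mono) auto
  finally show ?case by simp
qed simp

text \<open>Shifting and scaling sends the spectral range from \<open>- lam\<close> to
  \<open>lam\<close> onto the unit interval and the eigenvalue \<open>lam\<close> to 1, so powers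
  fix the eigenspace and shrink the other contributions.\<close>

definition lazy :: "('a \<Rightarrow> real) \<Rightarrow> 'a \<Rightarrow> real" where
  "lazy y v = (y v + adj y v / lam) / 2"

abbreviation lpow :: "nat \<Rightarrow> ('a \<Rightarrow> real) \<Rightarrow> 'a \<Rightarrow> real" where
  "lpow j \<equiv> (lazy ^^ j)"

lemma ip_lazy: "ip V y (lazy z) = (ip V y z + ip V y (adj z) / lam) / 2"
proof -
  have "lazy z = (\<lambda>v. (1 / 2) * z v + (1 / (2 * lam)) * adj z v)"
    by (simp add: lazy_def fun_eq_iff add_divide_distrib)
  then show ?thesis by (simp only: ip_lin_right) (simp add: field_simps)
qed

lemma ip_lazy_commute: "ip V y (lazy z) = ip V (lazy y) z"
proof -
  have "ip V (lazy y) z = (ip V z y + ip V z (adj y) / lam) / 2"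
    unfolding ip_lazy[symmetric] by (rule ip_commute)
  also have "ip V z y = ip V y z" by (rule ip_commute)
  also have "ip V z (adj y) = ip V y (adj z)" 
    using ip_adj_commute[of y z] ip_commute[of V "adj y" z] by simp
  finally show ?thesis unfolding ip_lazy by simp
qed

lemma lazy_lin: "lazy (\<lambda>w. a * y w + b * z w) = (\<lambda>w. a * lazy y w + b * lazy z w)"
  using lam_pos by (simp add: fun_eq_iff lazy_def adj_lin field_simps)

lemma lpow_lin: "lpow j (\<lambda>w. a * y w + b * z w) = (\<lambda>w. a * lpow j y w + b * lpow j z w)"
  by (induction j) (simp_all add: lazy_lin)

lemma ip_lpow: "ip V (lpow i y) (lpow j z) = ip V y (lpow (i + j) z)"
proof (induction i arbitrary: j)
  case (Suc i)
  have "ip V (lpow (Suc i) y) (lpow j z) = ip V (lpow i y) (lpow (Suc j) z)"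
    by (simp add: ip_lazy_commute)
  also have "\<dots> = ip V y (lpow (i + Suc j) z)" by (rule Suc.IH)
  finally show ?case by simp
qed simp

lemma supported_lazy:
  assumes "supported (nbhd v k) y"
  shows "supported (nbhd v (Suc k)) (lazy y)"
  unfolding supported_def
proof (intro allI impI)
  fix w assume w: "w \<notin> nbhd v (Suc k)"
  have "u \<notin> nbhd v k" if "u \<in> nb w" for u
    using w that E_sym by (auto simp: nb_def)
  then have "adj y w = 0" using assms by (auto simp: adj_def supported_def intro!: sum.neutral)
  then show "lazy y w = 0" using assms w by (simp add: lazy_def supported_def)
qed

text \<open>Finite propagation speed: this is why a hypothesis \<open>form_le\<close> on a ball
  suffices for statements about powers near its centre.\<close>

lemma supported_lpow:
  "supported (nbhd v k) y \<Longrightarrow> supported (nbhd v (k + j)) (lpow j y)"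
proof (induction j)
  case (Suc j)
  then show ?case using supported_lazy[of v "k + j"] by simp
qed simp

lemma supported_add: "supported W y \<Longrightarrow> supported W z \<Longrightarrow> supported W (\<lambda>w. a * y w + b * z w)"
  by (simp add: supported_def)

lemma lazy_form_le:
  assumes "form_le W" "supported W y"
  shows "ip V y (lazy y) \<le> ip V y y"
  using assms lam_pos by (simp add: form_le_def ip_lazy field_simps)

text \<open>This needs the lower bound \<open>A \<ge> - lam\<close> on \<open>W\<close>, which
  follows from the upper bound applied to the absolute value of \<open>y\<close>.\<close>

lemma lazy_form_nonneg:
  assumes "form_le W" "supported W y"
  shows "0 \<le> ip V y (lazy y)"
proof -
  have "supported W (absf y)" using assms(2) by (simp add: supported_def absf_def)
  then have "ip V (absf y) (adj (absf y)) \<le> lam * ip V y y"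
    using assms(1) unfolding form_le_def ip_abs[symmetric, of y] by blast
  with ip_adj_abs[of y] have "\<bar>ip V y (adj y)\<bar> \<le> lam * ip V y y" by (rule order.trans)
  then have "- ip V y y * lam \<le> ip V y (adj y)" by (simp add: abs_le_iff mult.commute)
  then have "- ip V y y \<le> ip V y (adj y) / lam"
    using lam_pos by (simp only: pos_le_divide_eq)
  then show ?thesis by (simp add: ip_lazy)
qed

lemma lazy_form_abs: "ip V y (lazy y) \<le> ip V (absf y) (lazy (absf y))"
proof -
  have "ip V y (adj y) \<le> ip V (absf y) (adj (absf y))"
    using ip_adj_abs[of y] by linarith
  then show ?thesis
    using lam_pos by (simp add: ip_lazy ip_abs divide_right_mono)
qed

text \<open>As long as the iterates stay in \<open>W\<close>, the numbers \<open>a j\<close> behave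
  like the moments of a measure on the unit interval: they are convex and nonincreasing in
  \<open>j\<close>.\<close>

lemma moments:
  assumes W: "form_le W" and supp: "\<And>j. j \<le> M \<Longrightarrow> supported W (lpow j x)"
  defines "a \<equiv> \<lambda>j. ip V x (lpow j x)"
  shows "j < 2 * M \<Longrightarrow> 0 \<le> a j - 2 * a (Suc j) + a (Suc (Suc j))"
    and "j \<le> 2 * M \<Longrightarrow> a (Suc j) \<le> a j"
proof -
  have sq: "ip V (lpow i x) (lpow j x) = a (i + j)" for i j
    by (simp add: a_def ip_lpow)
  have convex: "0 \<le> a j - 2 * a (Suc j) + a (Suc (Suc j))" if "j < 2 * M" for j
  proof -
    define i where "i = j div 2"
    \<comment> \<open>With \<open>z = (1 - L) L\<^sup>i x\<close>, the second difference is the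
      square norm of \<open>z\<close> for even \<open>j\<close> and the form of \<open>L\<close> at
      \<open>z\<close> for odd \<open>j\<close>.\<close>
    define z where "z = (\<lambda>w. 1 * lpow i x w + (-1) * lpow (Suc i) x w)"
    have lz: "lazy z = (\<lambda>w. 1 * lpow (Suc i) x w + (-1) * lpow (Suc (Suc i)) x w)"
      unfolding z_def lazy_lin by simp
    show ?thesis
    proof (cases "even j")
      case True
      then have "j = i + i" by (auto simp: i_def)
      moreover have "0 \<le> ip V z z" by simp
      ultimately show ?thesis
        unfolding z_def ip_lin_left ip_lin_right sq by simp
    next
      case False
      then have j: "j = Suc (i + i)" using i_def by presburger
      then have "supported W z"
        unfolding z_def using that by (intro supported_add supp) auto
      then have "0 \<le> ip V z (lazy z)" by (rule lazy_form_nonneg[OF W])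
      then show ?thesis
        unfolding lz unfolding z_def ip_lin_left ip_lin_right sq by (simp add: j)
    qed
  qed
  then show "j < 2 * M \<Longrightarrow> 0 \<le> a j - 2 * a (Suc j) + a (Suc (Suc j))" .
  have even: "a (Suc (2 * i)) \<le> a (2 * i)" if "i \<le> M" for i
    using lazy_form_le[OF W supp[OF that]] sq[of i i] sq[of i "Suc i"] by (simp add: mult_2)
  show "a (Suc j) \<le> a j" if "j \<le> 2 * M"
  proof (cases "even j")
    case True
    then obtain i where "j = 2 * i" by (rule evenE)
    then show ?thesis using even[of i] that by simp
  next
    case False
    then obtain i where i: "j = 2 * i + 1" by (rule oddE)
    \<comment> \<open>By convexity an odd decrement is at least the following even one, which is
      nonnegative.\<close>
    then have "Suc i \<le> M" "j < 2 * M" using that by presburger+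
    then show ?thesis using even[of "Suc i"] convex[of j] i by simp
  qed
qed

section \<open>Entries of the powers of the lazy operator\<close>

lemma supported_indicator: "u \<in> W \<Longrightarrow> supported W (indicator {u})"
  by (auto simp: supported_def indicator_def)

definition ret :: "nat \<Rightarrow> 'a \<Rightarrow> 'a \<Rightarrow> real" where
  "ret m v = lpow m (indicator {v})"

lemma ret_commute:
  assumes "u \<in> V" "v \<in> V"
  shows "ret m v u = ret m u v"
proof -
  have "ret m v u = ip V (lpow 0 (indicator {u})) (lpow m (indicator {v}))"
    using assms finite_V by (simp add: ret_def ip_indicator)
  also have "\<dots> = ip V (lpow m (indicator {u})) (lpow 0 (indicator {v}))"
    by (simp only: ip_lpow add_0_left add_0_right)
  also have "\<dots> = ret m u v"
    using assms finite_V by (simp add: ret_def ip_indicator)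
  finally show ?thesis .
qed

lemma lazy_nonneg: "(\<And>w. y w \<ge> 0) \<Longrightarrow> lazy y v \<ge> y v / 2"
  using lam_pos by (simp add: lazy_def adj_def sum_nonneg field_simps)

text \<open>Each application of \<open>lazy\<close> keeps at least half of the value at
  \<open>v\<close>, and nothing negative appears.\<close>

lemma ret_pos: "ret m v v > 0"
proof -
  have "(\<forall>w. lpow m (indicator {v}) w \<ge> 0) \<and> lpow m (indicator {v}) v > 0"
  proof (induction m)
    case (Suc m)
    then have *: "lazy (lpow m (indicator {v})) w \<ge> lpow m (indicator {v}) w / 2" for w
      by (intro lazy_nonneg) auto
    have "0 \<le> lpow m (indicator {v}) w / 2" "0 < lpow m (indicator {v}) v / 2" for w
      using Suc by auto
    then have "0 \<le> lazy (lpow m (indicator {v})) w" "0 < lazy (lpow m (indicator {v})) v" for w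
      using *[of w] *[of v] by (meson order.trans less_le_trans)+
    then show ?case by simp
  qed simp
  then show ?thesis by (simp add: ret_def)
qed

lemma eigen_ip_lpow:
  assumes f: "eigenfamily k f" "i < k"
  shows "ip V (f i) (lpow j y) = ip V (f i) y"
proof (induction j)
  case (Suc j)
  have "ip V (f i) (lpow (Suc j) y) = ip V (lazy (f i)) (lpow j y)"
    by (simp add: ip_lazy_commute)
  also have "\<dots> = ip V (f i) (lpow j y)"
    using f lam_pos by (intro ip_cong) (auto simp: lazy_def eigenfamily_def)
  finally show ?case using Suc by simp
qed simp

text \<open>For \<open>m = 2 h\<close> the entry is the square norm of
  \<open>L\<^sup>h \<delta>\<^sub>v\<close>. Its coefficients along the family are those of
  \<open>\<delta>\<^sub>v\<close>, because \<open>L\<close> fixes each eigenvector, so Bessel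
  applies.\<close>

lemma mass_le_ret:
  assumes f: "eigenfamily k f" and v: "v \<in> V" and m: "even m"
  shows "mass k f v \<le> ret m v v"
proof -
  obtain h where h: "m = h + h" using m by (auto elim: evenE simp: mult_2)
  let ?g = "lpow h (indicator {v})"
  have "mass k f v = (\<Sum>i<k. (ip V (f i) ?g)\<^sup>2)"
    unfolding mass_def using f v finite_V
    by (intro sum.cong) (auto simp: eigen_ip_lpow ip_indicator)
  also have "\<dots> \<le> ip V ?g ?g"
    using f by (intro bessel) (simp add: eigenfamily_def)
  also have "\<dots> = ret m v v"
    using v finite_V by (simp add: ip_lpow ip_indicator ret_def h)
  finally show ?thesis .
qed

text \<open>Cauchy-Schwarz for the semidefinite form of \<open>1 - L\<close> against the unit vector
  at \<open>y\<close>, where this form has the value 1/2: a small form forces \<open>w\<close> to be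
  nearly fixed by \<open>L\<close> at every vertex of \<open>W\<close>.\<close>

lemma form_cauchy:
  assumes W: "form_le W" and w: "supported W w" and y: "y \<in> V" "y \<in> W"
  shows "2 * (w y - lazy w y)\<^sup>2 \<le> ip V w w - ip V w (lazy w)"
proof -
  define d where "d = (indicator {y} :: 'a \<Rightarrow> real)"
  define B where "B = w y - lazy w y"
  \<comment> \<open>The minimiser of \<open>2 * s * B + s\<^sup>2 / 2\<close>.\<close>
  define s where "s = - 2 * B"
  define z where "z = (\<lambda>u. 1 * w u + s * d u)"
  have lz: "lazy z = (\<lambda>u. 1 * lazy w u + s * lazy d u)" unfolding z_def by (rule lazy_lin)
  have "adj d y = 0"
    unfolding adj_def d_def by (rule sum.neutral) (auto simp: nb_def indicator_def E_irrefl)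
  then have "lazy d y = 1 / 2" by (simp add: lazy_def d_def)
  then have dd: "ip V d (lazy d) = 1 / 2" "ip V d d = 1"
    using y finite_V by (simp_all add: d_def ip_indicator)
  have wd: "ip V w d = w y" "ip V d w = w y" "ip V d (lazy w) = lazy w y" "ip V w (lazy d) = lazy w y"
    using y finite_V ip_lazy_commute[of w d] by (simp_all add: d_def ip_indicator)
  have "supported W z"
    unfolding z_def using w y by (intro supported_add) (auto simp: d_def supported_indicator)
  then have "0 \<le> ip V z z - ip V z (lazy z)" using lazy_form_le[OF W] by simp
  also have "\<dots> = ip V w w - ip V w (lazy w) + 2 * s * B + s\<^sup>2 / 2"
    unfolding lz unfolding z_def ip_lin_left ip_lin_right
    by (simp add: dd wd B_def power2_eq_square algebra_simps)
  also have "\<dots> = ip V w w - ip V w (lazy w) - 2 * B\<^sup>2"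
    by (simp add: s_def power2_eq_square)
  finally show ?thesis by (simp add: B_def)
qed

text \<open>
  The function \<open>L\<^sup>m (G\<^sub>u\<^sub>v \<delta>\<^sub>v - G\<^sub>v\<^sub>v \<delta>\<^sub>u)\<close> vanishes at \<open>v\<close>; its absolute value is an approximate top
  eigenvector, and such a vector cannot vanish next to a vertex where it is large.
\<close>

lemma ret_near_rank_one:
  assumes v: "v \<in> V" and W: "form_le (nbhd v (m + 2))" and m: "m > 0"
    and t: "t = v \<or> E v t" and u: "u = t \<or> E t u"
  shows "ret m u u * ret m v v - (ret m v u)\<^sup>2 \<le> 2 * lam\<^sup>2 * (lam + 1)\<^sup>2 * ret m v v / m"
proof -
  define q where "q = ret m v v"
  define g where "g = ret m v u"
  \<comment> \<open>The determinant of the 2 by 2 submatrix of \<open>L\<^sup>m\<close> at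
    \<open>u\<close> and \<open>v\<close>; being nearly of rank one means that it is small.\<close>
  define D where "D = ret m u u * q - g\<^sup>2"
  define W' where "W' = nbhd v (m + 2)"
  define x where "x = (\<lambda>w. g * indicator {v} w + (- q) * indicator {u} w :: real)"
  define a where "a j = ip V x (lpow j x)" for j
  define h where "h = lpow m x"
  \<comment> \<open>The defect of the absolute value of \<open>h\<close> as a top
    eigenvector.\<close>
  define F where "F = ip V (absf h) (absf h) - ip V (absf h) (lazy (absf h))"
  have tV: "t \<in> V" and uV: "u \<in> V" using v t u E_in_V E_sym by blast+
  have inW: "v \<in> W'" "t \<in> W'" "u \<in> nbhd v 2"
    using nbhd_mono[of 0 "m + 2" v] nbhd_mono[of 1 "m + 2" v] t u
    by (auto simp: W'_def nb_def numeral_2_eq_2 E_sym)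
  have gs: "ret m u v = g" using ret_commute[OF uV v] by (simp add: g_def)
  have h_eq: "h = (\<lambda>w. g * ret m v w + (- q) * ret m u w)"
    unfolding h_def x_def lpow_lin ret_def ..
  have hv: "h v = 0"
    using gs by (simp add: h_eq q_def)
  have hu: "h u = - D"
    by (simp add: h_eq D_def power2_eq_square g_def)
  have am: "a m = q * D"
    unfolding a_def h_def[symmetric]
    unfolding x_def ip_lin_left using v uV finite_V hv hu by (simp add: ip_indicator)
  have hh: "ip V h h = a (2 * m)" "ip V h (lazy h) = a (Suc (2 * m))"
    using ip_lpow[of m x "Suc m" x] by (simp_all add: h_def a_def ip_lpow mult_2)
  have x2: "supported (nbhd v 2) x"
    unfolding x_def using inW nbhd_mono[of 0 2 v]
    by (intro supported_add supported_indicator) auto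
  have supp: "supported W' (lpow j x)" if "j \<le> m" for j
    unfolding W'_def using that by (intro supported_mono[OF supported_lpow[OF x2] nbhd_mono]) simp
  have "F \<le> ip V h h - ip V h (lazy h)"
    unfolding F_def ip_abs using lazy_form_abs[of h] by simp
  also have "\<dots> = a (2 * m) - a (Suc (2 * m))" by (simp add: hh)
  finally have "m * F \<le> m * (a (2 * m) - a (Suc (2 * m)))"
    by (intro mult_left_mono) auto
  \<comment> \<open>Convexity between \<open>m\<close> and \<open>2 * m\<close>: the last decrement,
    which bounds \<open>F\<close>, is at most \<open>a m / m\<close>, and
    \<open>a m = q * D\<close>.\<close>
  also have "a (2 * m) + m * (a (2 * m) - a (Suc (2 * m))) \<le> a m"
    using convex_sequence_decay[of "2 * m" a m] moments(1)[OF W[folded W'_def] supp]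
    unfolding a_def by simp
  then have "m * (a (2 * m) - a (Suc (2 * m))) \<le> a m"
    using hh(1) ip_self_nonneg[of V h] by simp
  finally have F: "m * F \<le> q * D" by (simp add: am)
  \<comment> \<open>A one-step Harnack inequality: at an approximate eigenvector, a neighbour of
    \<open>y\<close> cannot carry much more than \<open>lam\<close> times the value at
    \<open>y\<close>.\<close>
  have step: "absf h z \<le> lam * absf h y + 2 * lam * sqrt (F / 2)"
    if y: "y \<in> V" "y \<in> W'" and z: "E y z" for y z
  proof -
    have "supported W' (absf h)" using supp[of m] by (simp add: h_def supported_def absf_def)
    then have "2 * (absf h y - lazy (absf h) y)\<^sup>2 \<le> F"
      unfolding F_def by (rule form_cauchy[OF W[folded W'_def] _ y])
    then have "\<bar>absf h y - lazy (absf h) y\<bar> \<le> sqrt (F / 2)"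
      by (intro real_le_rsqrt) simp
    then have "lazy (absf h) y \<le> absf h y + sqrt (F / 2)" by linarith
    then have "adj (absf h) y \<le> lam * absf h y + 2 * lam * sqrt (F / 2)"
      using lam_pos by (simp add: lazy_def field_simps)
    moreover have "absf h z \<le> adj (absf h) y"
      unfolding adj_def using z by (intro member_le_sum finite_nb) (auto simp: nb_def absf_def)
    ultimately show ?thesis by linarith
  qed
  have FD: "0 \<le> F"
  proof -
    have "supported W' (absf h)" using supp[of m] by (simp add: h_def supported_def absf_def)
    then show ?thesis
      using form_cauchy[OF W[folded W'_def] _ v inW(1), of "absf h"] unfolding F_def
      by (meson order.trans zero_le_mult_iff zero_le_numeral zero_le_power2)
  qed
  define \<delta> where "\<delta> = 2 * lam * sqrt (F / 2)"
  have \<delta>: "0 \<le> \<delta>" using lam_pos FD by (simp add: \<delta>_def)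
  \<comment> \<open>Two steps along the walk from \<open>v\<close> over \<open>t\<close> to
    \<open>u\<close>, starting from \<open>h v = 0\<close>.\<close>
  have ht: "absf h t \<le> \<delta>"
    using t step[OF v inW(1), of t] hv \<delta> by (auto simp: \<delta>_def absf_def)
  have "absf h u \<le> (lam + 1) * \<delta>"
  proof (cases "u = t")
    case True
    moreover have "0 \<le> lam * \<delta>" using \<delta> lam_pos by simp
    ultimately show ?thesis using ht by (simp add: algebra_simps)
  next
    case False
    then have "absf h u \<le> lam * absf h t + \<delta>" using u step[OF tV inW(2)] by (simp add: \<delta>_def)
    also have "\<dots> \<le> lam * \<delta> + \<delta>" using ht lam_pos by simp
    finally show ?thesis by (simp add: algebra_simps)
  qed
  then have D: "\<bar>D\<bar> \<le> (lam + 1) * \<delta>" by (simp add: absf_def hu)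
  define K where "K = 2 * lam\<^sup>2 * (lam + 1)\<^sup>2"
  have K: "0 \<le> K" by (simp add: K_def)
  have q: "0 < q" by (simp add: q_def ret_pos)
  show ?thesis
  proof (cases "D > 0")
    case True
    \<comment> \<open>\<open>D\<close> is at most of the order of the square root of
      \<open>F\<close>, while \<open>F\<close> is at most \<open>q * D / m\<close>; dividing by
      \<open>D\<close> leaves the bound.\<close>
    have "D\<^sup>2 \<le> ((lam + 1) * \<delta>)\<^sup>2" using D by (simp add: abs_le_square_iff[symmetric])
    also have "\<dots> = K * F" using FD by (simp add: \<delta>_def K_def power_mult_distrib)
    finally have "m * D\<^sup>2 \<le> K * (m * F)" using m by (simp add: mult.left_commute)
    also have "\<dots> \<le> K * (q * D)" using F K by (intro mult_left_mono)
    finally have "D * (m * D) \<le> D * (K * q)" by (simp add: power2_eq_square mult_ac)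
    then have "m * D \<le> K * q" using True by simp
    then have "D \<le> K * q / m" using m by (simp add: field_simps)
    then show ?thesis by (simp add: D_def K_def q_def g_def)
  next
    case False
    moreover have "0 \<le> K * q / m" using K q by simp
    ultimately have "D \<le> K * q / m" by linarith
    then show ?thesis by (simp add: D_def K_def q_def g_def)
  qed
qed

text \<open>The threshold \<open>\<tau>\<close> turns the additive error of
  \<open>ret_near_rank_one\<close> into the relative error \<open>\<epsilon>\<close>. After that the
  squares in column \<open>v\<close> are compared with its square norm.\<close>

lemma sum_ret_nbhd_le:
  fixes \<epsilon> \<tau> :: real
  assumes v: "v \<in> V" and W: "form_le (nbhd v (m + 2))"
    and m: "2 * lam\<^sup>2 * (lam + 1)\<^sup>2 \<le> \<epsilon> * \<tau> * m" "m > 0" "\<epsilon> > 0"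
    and S: "S \<subseteq> nbhd v 2" "\<And>u. u \<in> S \<Longrightarrow> ret m u u \<ge> \<tau>"
  shows "(1 - \<epsilon>) * (\<Sum>u\<in>S. ret m u u) \<le> 1"
proof -
  define q where "q = ret m v v"
  have q: "q > 0" by (simp add: q_def ret_pos)
  have SV: "S \<subseteq> V" using S(1) nbhd_subset[OF v] by blast
  have one: "(1 - \<epsilon>) * ret m u u * q \<le> (ret m v u)\<^sup>2" if u: "u \<in> S" for u
  proof -
    have "u \<in> nbhd v 2" using u S by auto
    then obtain t where "t = v \<or> E v t" "u = t \<or> E t u"
      by (auto simp: numeral_2_eq_2 nb_def E_commute)
    then have "ret m u u * q - (ret m v u)\<^sup>2 \<le> 2 * lam\<^sup>2 * (lam + 1)\<^sup>2 * q / m"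
      unfolding q_def by (rule ret_near_rank_one[OF v W m(2)])
    also have "\<dots> \<le> \<epsilon> * \<tau> * q"
      using mult_right_mono[OF m(1), of q] q m by (simp add: field_simps)
    also have "\<dots> \<le> \<epsilon> * ret m u u * q"
      using S(2)[OF u] m q by (intro mult_right_mono mult_left_mono) auto
    finally show ?thesis by (simp add: algebra_simps)
  qed
  have "((1 - \<epsilon>) * (\<Sum>u\<in>S. ret m u u)) * q = (\<Sum>u\<in>S. (1 - \<epsilon>) * ret m u u * q)"
    by (simp add: sum_distrib_left sum_distrib_right)
  also have "\<dots> \<le> (\<Sum>u\<in>S. (ret m v u)\<^sup>2)" using one by (rule sum_mono)
  also have "\<dots> \<le> (\<Sum>u\<in>V. (ret m v u)\<^sup>2)"
    using SV finite_V by (intro sum_mono2) auto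
  also have "\<dots> = ip V (lpow m (indicator {v})) (lpow m (indicator {v}))"
    by (simp add: ip_def ret_def power2_eq_square)
  also have "\<dots> = ip V (indicator {v}) (lpow (m + m) (indicator {v}))" by (rule ip_lpow)
  \<comment> \<open>The square norm of the column is the moment of order \<open>2 * m\<close>, which
    does not exceed the moment of order \<open>m\<close>.\<close>
  also have "\<dots> \<le> ip V (indicator {v}) (lpow m (indicator {v}))"
  proof -
    have v0: "supported (nbhd v 0) (indicator {v})" by (simp add: supported_indicator)
    have supp: "supported (nbhd v (m + 2)) (lpow j (indicator {v}))" if "j \<le> m" for j
      using that by (intro supported_mono[OF supported_lpow[OF v0] nbhd_mono]) simp
    define a where "a j = ip V (indicator {v}) (lpow j (indicator {v}))" for j
    have dec: "a (Suc j) \<le> a j" if "j \<le> 2 * m" for j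
      unfolding a_def using moments(2)[OF W supp] that by blast
    have "a (m + i) \<le> a m" if "i \<le> m" for i
      using that
    proof (induction i)
      case (Suc i)
      then show ?case using dec[of "m + i"] by simp
    qed simp
    from this[of m] show ?thesis by (simp add: a_def)
  qed
  also have "\<dots> = 1 * q"
    using v finite_V by (simp add: ip_indicator q_def ret_def)
  finally show ?thesis using q by (simp only: mult_le_cancel_right_pos)
qed

lemma finite_nbhd: "v \<in> V \<Longrightarrow> finite (nbhd v k)"
  by (rule finite_subset[OF nbhd_subset finite_V])

section \<open>Local failures of \<open>A \<le> lam\<close> and the resulting dimension
  bound\<close>

definition orthogonal_form_le :: bool where
  "orthogonal_form_le \<longleftrightarrow> (\<forall>y. ip V y (\<lambda>_. 1) = 0 \<longrightarrow> ip V y (adj y) \<le> lam * ip V y y)"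

lemma separated_ip:
  assumes "\<And>u w. y u \<noteq> 0 \<Longrightarrow> z w \<noteq> 0 \<Longrightarrow> u \<noteq> w \<and> \<not> E u w"
  shows "ip V y z = 0" "ip V y (adj z) = 0" "ip V z y = 0" "ip V z (adj y) = 0"
proof -
  show "ip V y z = 0"
    unfolding ip_def using assms by (intro sum.neutral) (metis mult_eq_0_iff)
  then show "ip V z y = 0" by (simp add: ip_commute)
  show *: "ip V y (adj z) = 0"
    unfolding ip_adj using assms by (intro sum.neutral ballI) (metis mult_eq_0_iff of_bool_eq_0_iff)
  then show "ip V z (adj y) = 0" by (metis ip_adj_commute ip_commute)
qed

text \<open>A combination \<open>x\<close> of \<open>y\<close> and \<open>z\<close> is orthogonal to
  the constants, and separation removes the cross terms. The coefficient of \<open>z\<close> is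
  nonzero since \<open>y\<close> has positive sum, so strict excess is needed only for
  \<open>z\<close>.\<close>

lemma no_two_excesses:
  assumes perp: orthogonal_form_le
    and sep: "\<And>u w. y u \<noteq> 0 \<Longrightarrow> z w \<noteq> 0 \<Longrightarrow> u \<noteq> w \<and> \<not> E u w"
    and y: "ip V y (\<lambda>_. 1) > 0" "ip V y (adj y) \<ge> lam * ip V y y"
    and z: "ip V z (adj z) > lam * ip V z z"
  shows False
proof -
  define a b where "a = ip V z (\<lambda>_. 1)" and "b = - ip V y (\<lambda>_. 1)"
  define x where "x = (\<lambda>w. a * y w + b * z w)"
  note s = separated_ip[OF sep]
  have adjx: "adj x = (\<lambda>w. a * adj y w + b * adj z w)"
    unfolding x_def by (rule ext) (rule adj_lin)
  have xx: "ip V x x = a\<^sup>2 * ip V y y + b\<^sup>2 * ip V z z"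
    unfolding x_def ip_lin_left ip_lin_right by (simp add: s power2_eq_square)
  have xAx: "ip V x (adj x) = a\<^sup>2 * ip V y (adj y) + b\<^sup>2 * ip V z (adj z)"
    unfolding adjx unfolding x_def ip_lin_left ip_lin_right by (simp add: s power2_eq_square)
  have "ip V x (\<lambda>_. 1) = 0"
    unfolding x_def ip_lin_left by (simp add: a_def b_def)
  then have "ip V x (adj x) \<le> lam * ip V x x" using perp by (simp add: orthogonal_form_le_def)
  moreover have "a\<^sup>2 * (lam * ip V y y) \<le> a\<^sup>2 * ip V y (adj y)" using y by (intro mult_left_mono) auto
  moreover have "b\<^sup>2 * (lam * ip V z z) < b\<^sup>2 * ip V z (adj z)"
    using y z by (intro mult_strict_left_mono) (auto simp: b_def)
  ultimately show False by (simp add: xx xAx algebra_simps)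
qed

lemma excess_witness:
  assumes "\<not> form_le W"
  obtains y where "supported W y" "\<And>w. y w \<ge> 0" "ip V y (\<lambda>_. 1) > 0"
    "ip V y (adj y) > lam * ip V y y"
proof -
  obtain x where x: "supported W x" "ip V x (adj x) > lam * ip V x x"
    using assms by (auto simp: form_le_def not_le)
  have "\<exists>v\<in>V. x v \<noteq> 0"
  proof (rule ccontr)
    assume "\<not> ?thesis"
    then have "ip V x (adj x) = 0" "ip V x x = 0" by (simp_all add: ip_def)
    then show False using x by simp
  qed
  then have pos: "ip V (absf x) (\<lambda>_. 1) > 0"
    unfolding ip_def using finite_V by (auto simp: absf_def intro!: sum_pos2)
  have exc: "ip V (absf x) (adj (absf x)) > lam * ip V (absf x) (absf x)"
    using x(2) ip_adj_abs[of x] by (simp add: ip_abs)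
  show ?thesis
    by (rule that[of "absf x", OF _ _ pos exc]) (use x(1) in \<open>auto simp: supported_def absf_def\<close>)
qed

lemma bad_vertices_close:
  assumes perp: orthogonal_form_le
    and bad: "\<not> form_le (nbhd v R)" "\<not> form_le (nbhd v' R)"
  shows "v' \<in> nbhd v (2 * R + 1)"
proof (rule ccontr)
  assume far: "v' \<notin> nbhd v (2 * R + 1)"
  obtain y where y: "supported (nbhd v R) y" "ip V y (\<lambda>_. 1) > 0"
    "ip V y (adj y) > lam * ip V y y" using excess_witness[OF bad(1)] by metis
  obtain z where z: "supported (nbhd v' R) z" "ip V z (adj z) > lam * ip V z z"
    using excess_witness[OF bad(2)] by metis
  have "u \<noteq> w \<and> \<not> E u w" if "y u \<noteq> 0" "z w \<noteq> 0" for u w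
  proof (rule ccontr)
    assume "\<not> ?thesis"
    then have "w \<in> nbhd u 1" by (auto simp: nb_def)
    moreover have "u \<in> nbhd v R" using y(1) that by (auto simp: supported_def)
    moreover have "v' \<in> nbhd w R"
      by (rule nbhd_sym) (use z(1) that in \<open>auto simp: supported_def\<close>)
    ultimately have "v' \<in> nbhd v (R + 1 + R)" by (meson nbhd_trans)
    then show False using far by (simp add: mult_2)
  qed
  then show False using no_two_excesses[OF perp _ y(2) less_imp_le[OF y(3)] z(2)] by blast
qed

text \<open>Then \<open>nbhd u 1\<close> is a union of components. An eigenvector that is nonzero at
  \<open>u\<close> could be restricted to it, giving a nonnegative vector that attains
  \<open>lam\<close>; the excess, which cannot sit in this ball, lies elsewhere and contradicts
  \<open>no_two_excesses\<close>.\<close>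

lemma mass_eq_0_of_closed:
  assumes perp: orthogonal_form_le and excess: "\<not> form_le UNIV"
    and f: "eigenfamily k f" and u: "u \<in> V" "form_le (nbhd u R)" "R > 0"
    and closed: "nbhd u 2 \<subseteq> nbhd u 1"
  shows "mass k f u = 0"
proof (rule ccontr)
  assume "mass k f u \<noteq> 0"
  then have "\<exists>i<k. f i u \<noteq> 0" by (rule contrapos_np) (simp add: mass_def)
  then obtain i where i: "i < k" "f i u \<noteq> 0" by blast
  define K where "K = nbhd u 1"
  have nbK: "z \<in> K" if "w \<in> K" "E w z" for w z
    using that closed by (auto simp: K_def numeral_2_eq_2 nb_def)
  define g where "g w = (if w \<in> K then f i w else 0)" for w
  have adjg: "adj g w = lam * g w" if w: "w \<in> V" for w
  proof (cases "w \<in> K")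
    case True
    then have "adj g w = adj (f i) w"
      unfolding adj_def by (intro sum.cong) (use nbK in \<open>auto simp: g_def nb_def\<close>)
    then show ?thesis using f i w True by (simp add: g_def eigenfamily_def)
  next
    case False
    then have "adj g w = 0"
      unfolding adj_def by (intro sum.neutral) (use nbK E_sym in \<open>auto simp: g_def nb_def\<close>)
    then show ?thesis using False by (simp add: g_def)
  qed
  have "ip V g (adj g) = ip V g (\<lambda>w. lam * g w)" by (rule ip_cong) (simp_all add: adjg)
  then have "ip V g (adj g) = lam * ip V g g" by (simp add: ip_scale_right)
  then have gA: "ip V (absf g) (adj (absf g)) \<ge> lam * ip V (absf g) (absf g)"
    using ip_adj_abs[of g] by (simp add: ip_abs)
  have "u \<in> K" by (simp add: K_def)
  then have g1: "ip V (absf g) (\<lambda>_. 1) > 0"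
    unfolding ip_def using finite_V u(1) i(2) by (intro sum_pos2[of _ u]) (auto simp: absf_def g_def)
  obtain y where y: "ip V y (adj y) > lam * ip V y y"
    using excess_witness[OF excess] by metis
  \<comment> \<open>No edge joins \<open>K\<close> to its complement, so the form of
    \<open>y\<close> splits, and the part in \<open>K\<close> has no excess.\<close>
  define yK yC where "yK w = (if w \<in> K then y w else 0)" and "yC w = (if w \<in> K then 0 else y w)" for w
  have yd: "y = (\<lambda>w. 1 * yK w + 1 * yC w)" by (auto simp: yK_def yC_def)
  have adjy: "adj y = (\<lambda>w. 1 * adj yK w + 1 * adj yC w)"
    by (subst yd, rule ext) (rule adj_lin)
  have sep: "a \<noteq> b \<and> \<not> E a b" if "yK a \<noteq> 0" "yC b \<noteq> 0" for a b
    using that nbK by (auto simp: yK_def yC_def split: if_splits)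
  note s = separated_ip[OF sep]
  have "ip V y y = ip V yK yK + ip V yC yC"
    unfolding yd ip_lin_left ip_lin_right by (simp add: s)
  moreover have "ip V y (adj y) = ip V yK (adj yK) + ip V yC (adj yC)"
    unfolding adjy unfolding yd ip_lin_left ip_lin_right by (simp add: s)
  moreover have "supported (nbhd u R) yK"
    using nbhd_mono[of 1 R u] u(3) by (auto simp: supported_def yK_def K_def)
  then have "ip V yK (adj yK) \<le> lam * ip V yK yK" using u(2) by (simp add: form_le_def)
  ultimately have "ip V yC (adj yC) > lam * ip V yC yC" using y by (simp add: algebra_simps)
  moreover have "a \<noteq> b \<and> \<not> E a b" if "absf g a \<noteq> 0" "yC b \<noteq> 0" for a b
    using that nbK by (auto simp: absf_def g_def yC_def split: if_splits)
  ultimately show False using no_two_excesses[OF perp _ g1 gA] by blast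
qed

text \<open>The bound \<open>p \<le> d / (d + lam\<^sup>2)\<close> made linear in \<open>p\<close>
  and \<open>d * p\<close>, again by \<open>(d - lam)\<^sup>2 \<ge> 0\<close>. In this shape it can
  be summed against the ball estimate for \<open>(d + 2) * p\<close>.\<close>

lemma mass_linear_bound:
  assumes f: "eigenfamily k f" and v: "v \<in> V"
  defines "\<theta> \<equiv> 1 / (2 * (1 + lam))"
  shows "mass k f v * (1 - \<theta> * (1 + card (nb v))) \<le> \<theta>"
proof -
  define d p where "d = real (card (nb v))" and "p = mass k f v"
  have pd: "p * (d + lam\<^sup>2) \<le> d" using mass_bounds(2)[OF f v] by (simp add: p_def d_def)
  have pos: "d + lam\<^sup>2 > 0" using lam_pos by (simp add: d_def add_nonneg_pos)
  have \<theta>: "\<theta> > 0" "\<theta> * (2 * (1 + lam)) = 1" using lam_pos by (simp_all add: \<theta>_def)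
  have p0: "p \<ge> 0" by (simp add: p_def mass_nonneg)
  have "p * (1 - \<theta> * (1 + d)) \<le> \<theta>"
  proof (cases "1 - \<theta> * (1 + d) \<le> 0")
    case True
    then have "p * (1 - \<theta> * (1 + d)) \<le> 0" using p0 by (simp add: mult_nonneg_nonpos)
    then show ?thesis using \<theta> by linarith
  next
    case False
    have "(p * (1 - \<theta> * (1 + d))) * (d + lam\<^sup>2) = (p * (d + lam\<^sup>2)) * (1 - \<theta> * (1 + d))"
      by simp
    also have "\<dots> \<le> d * (1 - \<theta> * (1 + d))"
      using pd False by (intro mult_right_mono) auto
    also have "\<dots> = d * (\<theta> * (2 * (1 + lam)) - \<theta> * (1 + d))"
      by (simp only: \<theta>(2))
    also have "\<dots> = \<theta> * (d * (2 * (1 + lam)) - d * (1 + d))"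
      by (simp add: algebra_simps)
    also have "\<dots> \<le> \<theta> * (d + lam\<^sup>2)"
    proof -
      have "0 \<le> (d - lam)\<^sup>2" by simp
      then show ?thesis using \<theta>(1)
        by (intro mult_left_mono) (auto simp: power2_eq_square algebra_simps)
    qed
    finally show ?thesis using pos by (simp only: mult_le_cancel_right_pos)
  qed
  then show ?thesis by (simp add: p_def d_def)
qed

text \<open>The three terms bound the total mass on three sets of vertices: those close to a bad
  vertex, those of mass at most \<open>\<tau>\<close>, and the remaining set
  \<open>X\<close>.\<close>

lemma eigenfamily_bound_with_excess:
  fixes \<epsilon> \<tau> :: real
  assumes f: "eigenfamily k f" and perp: orthogonal_form_le and excess: "\<not> form_le UNIV"
    and deg: "\<And>u. u \<in> V \<Longrightarrow> card (nb u) \<le> \<Delta>"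
    and m: "even m" "m > 0" "2 * lam\<^sup>2 * (lam + 1)\<^sup>2 \<le> \<epsilon> * \<tau> * m"
    and \<epsilon>: "0 < \<epsilon>" "\<epsilon> \<le> 1 / 2" and \<tau>: "0 < \<tau>"
  shows "real k \<le> (real \<Delta> + 1) ^ (2 * m + 7) + \<tau> * card V + (1 + \<epsilon>) * card V / (lam + 3 / 2)"
proof -
  define p q where "p = mass k f" and "q u = ret m u u" for u
  define \<theta> where "\<theta> = 1 / (2 * (1 + lam))"
  have \<theta>: "\<theta> > 0" using lam_pos by (simp add: \<theta>_def)
  \<comment> \<open>\<open>\<Gamma>\<close> holds the vertices where the local estimates apply and
    \<open>\<Gamma>'\<close> those with their whole 2-ball in \<open>\<Gamma>\<close>. In
    \<open>X\<close>, moreover, \<open>q\<close> is large and the 2-ball is larger than the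
    1-ball.\<close>
  define \<Gamma> where "\<Gamma> = {v\<in>V. form_le (nbhd v (m + 2))}"
  define \<Gamma>' where "\<Gamma>' = {u\<in>V. nbhd u 2 \<subseteq> \<Gamma>}"
  define X where "X = {u\<in>\<Gamma>'. \<tau> \<le> q u \<and> \<not> nbhd u 2 \<subseteq> nbhd u 1}"
  have sub: "X \<subseteq> \<Gamma>'" "\<Gamma>' \<subseteq> V" "\<Gamma> \<subseteq> V" by (auto simp: X_def \<Gamma>'_def \<Gamma>_def)
  have fin: "finite X" "finite \<Gamma>'" "finite \<Gamma>"
    using finite_V by (simp_all add: X_def \<Gamma>'_def \<Gamma>_def)
  have p0: "p u \<ge> 0" for u by (simp add: p_def mass_nonneg)
  have pq: "p u \<le> q u" if "u \<in> V" for u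
    using mass_le_ret[OF f that m(1)] by (simp add: p_def q_def)
  have shallow: "real (card (V - \<Gamma>')) \<le> (real \<Delta> + 1) ^ (2 * m + 7)"
  proof (cases "V - \<Gamma>' = {}")
    case True
    then have "card (V - \<Gamma>') = 0" by (simp only: card.empty)
    then show ?thesis by simp
  next
    case False
    then obtain u0 v0 where v0: "u0 \<in> V" "v0 \<in> nbhd u0 2" "v0 \<notin> \<Gamma>"
      unfolding \<Gamma>'_def by blast
    then have v0V: "v0 \<in> V" using nbhd_subset by blast
    have "u \<in> nbhd v0 (2 * m + 7)" if u: "u \<in> V - \<Gamma>'" for u
    proof -
      obtain v where v: "u \<in> V" "v \<in> nbhd u 2" "v \<notin> \<Gamma>" using u unfolding \<Gamma>'_def by blast
      then have "v \<in> V" using nbhd_subset by blast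
      then have bad: "\<not> form_le (nbhd v0 (m + 2))" "\<not> form_le (nbhd v (m + 2))"
        using v(3) v0(3) v0V unfolding \<Gamma>_def by blast+
      \<comment> \<open>Any two bad vertices have distance at most \<open>2 * (m + 2) + 1\<close>,
        and \<open>u\<close> lies within 2 of one.\<close>
      have "u \<in> nbhd v0 (2 * (m + 2) + 1 + 2)"
        by (rule nbhd_trans[OF bad_vertices_close[OF perp bad] nbhd_sym[OF v(2)]])
      moreover have "2 * (m + 2) + 1 + 2 = 2 * m + 7" by simp
      ultimately show ?thesis by (simp only:)
    qed
    then have "card (V - \<Gamma>') \<le> card (nbhd v0 (2 * m + 7))"
      by (intro card_mono finite_nbhd v0V) blast
    also have "\<dots> \<le> (\<Delta> + 1) ^ (2 * m + 7)" using deg v0V by (rule card_nbhd_le)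
    finally have "real (card (V - \<Gamma>')) \<le> real ((\<Delta> + 1) ^ (2 * m + 7))" by (simp only: of_nat_le_iff)
    then show ?thesis by (simp add: add.commute)
  qed
  \<comment> \<open>The closed neighbourhood has \<open>d + 1\<close> vertices and the 2-ball at
    least one more; this extra vertex produces \<open>lam + 3 / 2\<close> in place of
    \<open>lam + 1\<close>.\<close>
  have c2: "real (card (nb u)) + 2 \<le> card (nbhd u 2)" if "u \<in> X" for u
  proof -
    have uV: "u \<in> V" using that sub by blast
    have n1: "nbhd u 1 = insert u (nb u)" by auto
    have "nbhd u 1 \<subset> nbhd u 2" using that nbhd_mono[of 1 2 u] by (auto simp: X_def)
    then have "card (nbhd u 1) < card (nbhd u 2)"
      by (intro psubset_card_mono finite_nbhd uV)
    moreover have "card (nbhd u 1) = card (nb u) + 1"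
    proof -
      have "u \<notin> nb u" by (simp add: nb_def E_irrefl)
      then show ?thesis unfolding n1 by simp
    qed
    ultimately show ?thesis by linarith
  qed
  have "(1 - \<epsilon>) * (\<Sum>u\<in>X. q u * card (nbhd u 2)) \<le> card V"
  proof -
    have eq: "nbhd u 2 = {v\<in>\<Gamma>. u \<in> nbhd v 2}" if "u \<in> X" for u
      using that nbhd_sym by (auto simp: X_def \<Gamma>'_def)
    \<comment> \<open>Double counting of the pairs \<open>u\<close> in \<open>X\<close>,
      \<open>v\<close> in \<open>\<Gamma>\<close> at distance at most 2, so that the estimate around
      each \<open>v\<close> can be used.\<close>
    have "(\<Sum>u\<in>X. q u * card (nbhd u 2)) = (\<Sum>u\<in>X. \<Sum>v\<in>{v\<in>\<Gamma>. u \<in> nbhd v 2}. q u)"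
      by (rule sum.cong[OF refl]) (simp add: mult.commute flip: eq)
    also have "\<dots> = (\<Sum>v\<in>\<Gamma>. \<Sum>u\<in>{u\<in>X. u \<in> nbhd v 2}. q u)"
      using fin by (intro sum.swap_restrict) auto
    finally have "(1 - \<epsilon>) * (\<Sum>u\<in>X. q u * card (nbhd u 2))
        = (\<Sum>v\<in>\<Gamma>. (1 - \<epsilon>) * (\<Sum>u\<in>{u\<in>X. u \<in> nbhd v 2}. q u))"
      by (simp add: sum_distrib_left)
    also have "\<dots> \<le> (\<Sum>v\<in>\<Gamma>. 1)"
      unfolding q_def using m \<epsilon>
      by (intro sum_mono sum_ret_nbhd_le[where \<tau> = \<tau>]) (auto simp: \<Gamma>_def X_def q_def)
    also have "\<dots> \<le> card V" using sub finite_V by (simp add: card_mono)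
    finally show ?thesis .
  qed
  moreover have "(\<Sum>u\<in>X. (card (nb u) + 2) * p u) \<le> (\<Sum>u\<in>X. q u * card (nbhd u 2))"
  proof (rule sum_mono)
    fix u assume u: "u \<in> X"
    then have "u \<in> V" using sub by blast
    then have "p u * (card (nb u) + 2) \<le> q u * card (nbhd u 2)"
      using pq p0 c2[OF u] by (intro mult_mono) (auto intro: order.trans)
    then show "(card (nb u) + 2) * p u \<le> q u * card (nbhd u 2)" by (simp add: mult.commute)
  qed
  moreover define Z where "Z = (\<Sum>u\<in>X. (card (nb u) + 2) * p u)"
  moreover have "0 \<le> 1 - \<epsilon>" using \<epsilon> by simp
  ultimately have Z: "(1 - \<epsilon>) * Z \<le> card V" by (meson mult_left_mono order.trans)
  have Z0: "0 \<le> Z" using p0 by (auto simp: Z_def intro!: sum_nonneg)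
  \<comment> \<open>For \<open>\<epsilon> \<le> 1 / 2\<close> the inverse of
    \<open>1 - \<epsilon>\<close> is at most \<open>1 + 2 * \<epsilon>\<close>.\<close>
  have "Z \<le> (1 + 2 * \<epsilon>) * (1 - \<epsilon>) * Z"
  proof -
    have "0 \<le> \<epsilon> * (1 - 2 * \<epsilon>) * Z" using \<epsilon> Z0 by simp
    then show ?thesis by (simp add: algebra_simps)
  qed
  also have "\<dots> \<le> (1 + 2 * \<epsilon>) * card V"
    using mult_left_mono[OF Z, of "1 + 2 * \<epsilon>"] \<epsilon> by (simp add: mult.assoc)
  finally have Z: "Z \<le> (1 + 2 * \<epsilon>) * card V" .
  have pX: "(1 + \<theta>) * (\<Sum>u\<in>X. p u) \<le> 2 * \<theta> * (1 + \<epsilon>) * card V"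
  proof -
    have "(1 + \<theta>) * p u \<le> \<theta> * ((card (nb u) + 2) * p u) + \<theta>" if "u \<in> X" for u
    proof -
      have "u \<in> V" using that sub by blast
      from mass_linear_bound[OF f this, folded \<theta>_def p_def] show ?thesis
        by (simp add: algebra_simps)
    qed
    then have "(\<Sum>u\<in>X. (1 + \<theta>) * p u) \<le> (\<Sum>u\<in>X. \<theta> * ((card (nb u) + 2) * p u) + \<theta>)"
      by (rule sum_mono)
    then have "(1 + \<theta>) * (\<Sum>u\<in>X. p u) \<le> \<theta> * Z + \<theta> * card X"
      by (simp add: sum_distrib_left sum.distrib Z_def mult.commute)
    also have "\<dots> \<le> \<theta> * ((1 + 2 * \<epsilon>) * card V) + \<theta> * card V"
      using Z \<theta> sub finite_V by (intro add_mono mult_left_mono) (auto intro: card_mono)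
    finally show ?thesis by (simp add: algebra_simps)
  qed
  have "(\<Sum>u\<in>X. p u) \<le> (1 + \<epsilon>) * card V / (lam + 3 / 2)"
  proof -
    have "(1 + \<theta>) * (2 * (1 + lam)) = 2 * (lam + 3 / 2)" "2 * \<theta> * (2 * (1 + lam)) = 2"
      using lam_pos by (simp_all add: \<theta>_def field_simps)
    moreover have "((1 + \<theta>) * (2 * (1 + lam))) * (\<Sum>u\<in>X. p u) \<le> (2 * \<theta> * (2 * (1 + lam))) * ((1 + \<epsilon>) * card V)"
      using mult_left_mono[OF pX, of "2 * (1 + lam)"] lam_pos by (simp only: mult_ac) simp
    ultimately have "2 * (lam + 3 / 2) * (\<Sum>u\<in>X. p u) \<le> 2 * ((1 + \<epsilon>) * card V)"
      by (simp only:)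
    then show ?thesis using lam_pos by (simp add: field_simps)
  qed
  moreover have "(\<Sum>u\<in>\<Gamma>' - X. p u) \<le> (\<Sum>u\<in>\<Gamma>' - X. \<tau>)"
  proof (rule sum_mono)
    fix u assume u: "u \<in> \<Gamma>' - X"
    then have uV: "u \<in> V" using sub by blast
    show "p u \<le> \<tau>"
    proof (cases "\<tau> \<le> q u")
      case True
      then have "nbhd u 2 \<subseteq> nbhd u 1" using u by (auto simp: X_def)
      moreover have "u \<in> \<Gamma>" using u nbhd_mono[of 0 2 u] by (auto simp: \<Gamma>'_def)
      ultimately have "p u = 0"
        unfolding p_def by (intro mass_eq_0_of_closed[OF perp excess f uV, of "m + 2"]) (auto simp: \<Gamma>_def)
      then show ?thesis using \<tau> by simp
    next
      case False
      then show ?thesis using pq[OF uV] by simp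
    qed
  qed
  moreover have "(\<Sum>u\<in>\<Gamma>' - X. \<tau>) \<le> \<tau> * card V"
  proof -
    have "card (\<Gamma>' - X) \<le> card V" using sub finite_V by (intro card_mono) auto
    then show ?thesis using \<tau> by (simp add: mult.commute)
  qed
  moreover have "(\<Sum>u\<in>V - \<Gamma>'. p u) \<le> (\<Sum>u\<in>V - \<Gamma>'. 1)"
    using mass_bounds(1)[OF f] by (intro sum_mono) (auto simp: p_def)
  moreover have "real k = (\<Sum>u\<in>V - \<Gamma>'. p u) + ((\<Sum>u\<in>\<Gamma>' - X. p u) + (\<Sum>u\<in>X. p u))"
    using sum_mass[OF f] sub fin finite_V
    by (simp add: p_def sum.subset_diff[OF sub(1) fin(2)] sum.subset_diff[OF sub(2) finite_V])
  ultimately show ?thesis using shallow by simp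
qed

end

subsection \<open>Equiangular vectors\<close>

text \<open>First variation at a maximiser of the form; \<open>s\<close> below minimises
  \<open>2 * s * B + s\<^sup>2 * lam\<close>, which would be negative if \<open>B\<close> were
  nonzero.\<close>

lemma (in weighted_graph) extremal_is_eigenvector:
  assumes le: "form_le UNIV" and eq: "ip V y (adj y) = lam * ip V y y" and v: "v \<in> V"
  shows "adj y v = lam * y v"
proof -
  define d where "d = (indicator {v} :: 'a \<Rightarrow> real)"
  define B where "B = lam * y v - adj y v"
  define s where "s = - B / lam"
  define z where "z = (\<lambda>u. 1 * y u + s * d u)"
  have adjz: "adj z = (\<lambda>u. 1 * adj y u + s * adj d u)"
    unfolding z_def by (rule ext) (rule adj_lin)
  have "adj d v = 0"
    unfolding adj_def d_def by (rule sum.neutral) (auto simp: nb_def indicator_def E_irrefl)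
  then have dd: "ip V d (adj d) = 0" "ip V d d = 1"
    using v finite_V by (simp_all add: d_def ip_indicator)
  have yd: "ip V y d = y v" "ip V d y = y v" "ip V d (adj y) = adj y v" "ip V y (adj d) = adj y v"
    using v finite_V ip_adj_commute[of y d] by (simp_all add: d_def ip_indicator)
  have "0 \<le> lam * ip V z z - ip V z (adj z)"
    using le by (simp add: form_le_def supported_def)
  also have "\<dots> = 2 * s * B + s\<^sup>2 * lam"
    unfolding adjz unfolding z_def ip_lin_left ip_lin_right
    by (simp add: dd yd eq B_def power2_eq_square algebra_simps)
  also have "\<dots> = - B\<^sup>2 / lam"
    using lam_pos by (simp add: s_def power2_eq_square field_simps)
  finally have "B\<^sup>2 \<le> 0" using lam_pos by (simp add: field_simps)
  then show ?thesis by (simp add: B_def)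
qed

lemma sum_indicator_card:
  assumes "finite A"
  shows "sum (indicator B) A = real (card (A \<inter> B))"
proof -
  have "sum (indicator B) A = (\<Sum>v\<in>A. if v \<in> B then 1 else (0 :: real))"
    by (rule sum.cong) auto
  then show ?thesis using assms by (simp add: sum.If_cases Int_def)
qed

locale equiangular_vectors =
  fixes V :: "'a set" and x :: "'a \<Rightarrow> 'b::euclidean_space" and \<alpha> :: real
  assumes fin_V: "finite V"
    and unit: "v \<in> V \<Longrightarrow> x v \<bullet> x v = 1"
    and equi: "u \<in> V \<Longrightarrow> v \<in> V \<Longrightarrow> u \<noteq> v \<Longrightarrow> \<bar>x u \<bullet> x v\<bar> = \<alpha>"
    and \<alpha>_pos: "0 < \<alpha>" and \<alpha>_less: "\<alpha> < 1"
begin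

definition neg :: "'a \<Rightarrow> 'a \<Rightarrow> bool" where
  "neg u v \<longleftrightarrow> u \<in> V \<and> v \<in> V \<and> u \<noteq> v \<and> x u \<bullet> x v = - \<alpha>"

definition lam :: real where "lam = (1 - \<alpha>) / (2 * \<alpha>)"

lemma lam_eq: "2 * \<alpha> * lam = 1 - \<alpha>"
  using \<alpha>_pos by (simp add: lam_def)

sublocale weighted_graph V neg lam
proof
  show "0 < lam" using \<alpha>_pos \<alpha>_less by (simp add: lam_def)
qed (auto simp: neg_def fin_V inner_commute)

lemma gram:
  assumes "u \<in> V" "v \<in> V"
  shows "x u \<bullet> x v = (1 - \<alpha>) * of_bool (u = v) + \<alpha> - 2 * \<alpha> * of_bool (neg u v)"
  using assms unit[of u] equi[of u v] \<alpha>_pos by (auto simp: neg_def)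

lemma inner_combination:
  assumes "u \<in> V"
  shows "(\<Sum>v\<in>V. y v *\<^sub>R x v) \<bullet> x u = (1 - \<alpha>) * y u + \<alpha> * ip V y (\<lambda>_. 1) - 2 * \<alpha> * adj y u"
proof -
  have "(\<Sum>v\<in>V. y v *\<^sub>R x v) \<bullet> x u
      = (\<Sum>v\<in>V. (if v = u then (1 - \<alpha>) * y v else 0) + \<alpha> * y v - 2 * \<alpha> * (of_bool (neg u v) * y v))"
    unfolding inner_sum_left
  proof (rule sum.cong[OF refl])
    fix v assume v: "v \<in> V"
    have "neg v u \<longleftrightarrow> neg u v" by (rule E_commute)
    with gram[OF v assms]
    have g: "x v \<bullet> x u = (1 - \<alpha>) * of_bool (v = u) + \<alpha> - 2 * \<alpha> * of_bool (neg u v)"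
      by (simp only:)
    show "(y v *\<^sub>R x v) \<bullet> x u
        = (if v = u then (1 - \<alpha>) * y v else 0) + \<alpha> * y v - 2 * \<alpha> * (of_bool (neg u v) * y v)"
      unfolding inner_scaleR_left g by (cases "v = u") (simp_all add: algebra_simps)
  qed
  also have "\<dots> = (1 - \<alpha>) * y u + \<alpha> * ip V y (\<lambda>_. 1) - 2 * \<alpha> * adj y u"
    using assms fin_V
    by (simp add: sum.distrib sum_subtractf ip_def adj_eq flip: sum_distrib_left)
  finally show ?thesis .
qed

lemma norm_combination:
  "(\<Sum>v\<in>V. y v *\<^sub>R x v) \<bullet> (\<Sum>v\<in>V. y v *\<^sub>R x v)
    = (1 - \<alpha>) * ip V y y + \<alpha> * (ip V y (\<lambda>_. 1))\<^sup>2 - 2 * \<alpha> * ip V y (adj y)"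
proof -
  let ?s = "ip V y (\<lambda>_. 1)"
  have "(\<Sum>v\<in>V. y v *\<^sub>R x v) \<bullet> (\<Sum>v\<in>V. y v *\<^sub>R x v)
      = (\<Sum>u\<in>V. y u * ((\<Sum>v\<in>V. y v *\<^sub>R x v) \<bullet> x u))"
    by (simp add: inner_sum_right)
  also have "\<dots> = (\<Sum>u\<in>V. y u * ((1 - \<alpha>) * y u + \<alpha> * ?s - 2 * \<alpha> * adj y u))"
    by (intro sum.cong) (auto simp: inner_combination)
  also have "\<dots> = (1 - \<alpha>) * ip V y y + \<alpha> * ?s * ip V y (\<lambda>_. 1) - 2 * \<alpha> * ip V y (adj y)"
    unfolding ip_def sum_distrib_left
    by (simp add: sum.distrib[symmetric] sum_subtractf[symmetric] algebra_simps)
  finally show ?thesis by (simp add: power2_eq_square)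
qed

lemma form_bound: "2 * \<alpha> * ip V y (adj y) \<le> 2 * \<alpha> * (lam * ip V y y) + \<alpha> * (ip V y (\<lambda>_. 1))\<^sup>2"
proof -
  have "2 * \<alpha> * (lam * ip V y y) = (1 - \<alpha>) * ip V y y" by (simp flip: lam_eq)
  then show ?thesis
    using norm_combination[of y] inner_ge_zero[of "\<Sum>v\<in>V. y v *\<^sub>R x v"] by linarith
qed

lemma orthogonal_form: orthogonal_form_le
  unfolding orthogonal_form_le_def
proof (intro allI impI)
  fix y assume "ip V y (\<lambda>_. 1) = 0"
  then have "2 * \<alpha> * ip V y (adj y) \<le> 2 * \<alpha> * (lam * ip V y y)" using form_bound[of y] by simp
  then show "ip V y (adj y) \<le> lam * ip V y y" using \<alpha>_pos by simp
qed

lemma eigen_of_relation: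
  assumes "(\<Sum>v\<in>V. y v *\<^sub>R x v) = 0" "ip V y (\<lambda>_. 1) = 0" "u \<in> V"
  shows "adj y u = lam * y u"
proof -
  have "2 * \<alpha> * adj y u = 2 * \<alpha> * (lam * y u)"
    using inner_combination[OF assms(3), of y] assms lam_eq by (simp flip: mult.assoc)
  then show ?thesis using \<alpha>_pos by simp
qed

lemma relation_if_coordinates:
  assumes "\<And>b. b \<in> Basis \<Longrightarrow> ip V (\<lambda>v. x v \<bullet> b) y = 0"
  shows "(\<Sum>v\<in>V. y v *\<^sub>R x v) = 0"
proof (rule euclidean_eqI)
  fix b :: 'b assume "b \<in> Basis"
  then show "(\<Sum>v\<in>V. y v *\<^sub>R x v) \<bullet> b = 0 \<bullet> b"
    using assms[of b] by (simp add: inner_sum_left ip_def mult.commute)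
qed

lemma exists_eigenfamily:
  assumes "k + DIM('b) + 1 \<le> card V"
  shows "\<exists>f. eigenfamily k f"
proof -
  \<comment> \<open>\<open>Some b\<close> stands for the coordinate equation along \<open>b\<close>,
    \<open>None\<close> for the equation that the coefficients sum to zero.\<close>
  define a where "a j v = (case j of None \<Rightarrow> 1 | Some b \<Rightarrow> x v \<bullet> b)" for j v
  define J where "J = insert None (Some ` (Basis :: 'b set))"
  have J: "finite J" "k + card J \<le> card V"
    using assms by (simp_all add: J_def card_image)
  obtain f where f: "orthonormal_on V k f" "\<forall>i<k. \<forall>j\<in>J. ip V (a j) (f i) = 0"
    using orthonormal_solutions[OF J(1) fin_V J(2), of a] by blast
  have "adj (f i) v = lam * f i v" if "i < k" "v \<in> V" for i v
  proof (rule eigen_of_relation[OF relation_if_coordinates _ that(2)])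
    show "ip V (\<lambda>v. x v \<bullet> b) (f i) = 0" if "b \<in> Basis" for b
    proof -
      have "a (Some b) = (\<lambda>v. x v \<bullet> b)" by (simp add: a_def fun_eq_iff)
      moreover have "Some b \<in> J" using that by (simp add: J_def)
      ultimately show ?thesis using f(2) \<open>i < k\<close> by metis
    qed
    show "ip V (f i) (\<lambda>_. 1) = 0"
    proof -
      have "a None = (\<lambda>_. 1)" by (simp add: a_def fun_eq_iff)
      moreover have "None \<in> J" by (simp add: J_def)
      ultimately show ?thesis using f(2) \<open>i < k\<close> by (subst ip_commute) metis
    qed
  qed
  then show ?thesis using f(1) by (auto simp: eigenfamily_def)
qed

text \<open>
  If \<open>A \<le> lam\<close>, then the eigenspace contains, besides the relations between the vectors, the absolute
  value of any nonzero relation, which is not a relation since its coordinates do not sum to zero.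
\<close>

lemma bound_if_form_le:
  assumes le: "form_le UNIV" and k: "k + DIM('b) = card V" "k > 0"
  shows "(real k + 1) * (1 + lam) \<le> card V"
proof -
  define a where "a b v = x v \<bullet> b" for b v
  obtain f where f: "orthonormal_on V k f" "\<forall>i<k. \<forall>b\<in>Basis. ip V (a b) (f i) = 0"
    using orthonormal_solutions[OF finite_Basis fin_V eq_imp_le[OF k(1)], of a] by blast
  have rel: "(\<Sum>v\<in>V. f i v *\<^sub>R x v) = 0" if "i < k" for i
    using f(2) that by (intro relation_if_coordinates) (auto simp: a_def[abs_def])
  \<comment> \<open>For a relation the Gram form vanishes, so \<open>\<alpha>\<close> times the
    square of the coefficient sum is a multiple of the form minus \<open>lam\<close>, which is not
    positive under \<open>le\<close>.\<close>
  have orth1: "ip V (f i) (\<lambda>_. 1) = 0" if "i < k" for i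
  proof -
    have "\<alpha> * (ip V (f i) (\<lambda>_. 1))\<^sup>2 = 2 * \<alpha> * ip V (f i) (adj (f i)) - (1 - \<alpha>) * ip V (f i) (f i)"
      using norm_combination[of "f i"] rel[OF that] by simp
    also have "\<dots> = 2 * \<alpha> * (ip V (f i) (adj (f i)) - lam * ip V (f i) (f i))"
      by (simp add: algebra_simps flip: lam_eq)
    also have "\<dots> \<le> 0"
      using le \<alpha>_pos by (intro mult_nonneg_nonpos) (auto simp: form_le_def supported_def)
    finally show ?thesis using \<alpha>_pos by (simp add: mult_le_0_iff)
  qed
  have eig: "adj (f i) v = lam * f i v" if "i < k" "v \<in> V" for i v
    using that by (intro eigen_of_relation rel orth1)
  define g0 where "g0 = absf (f 0)"
  have "ip V (f 0) (adj (f 0)) = ip V (f 0) (\<lambda>v. lam * f 0 v)"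
    by (rule ip_cong) (use eig k in auto)
  then have "lam * ip V g0 g0 \<le> ip V g0 (adj g0)"
    using ip_adj_abs[of "f 0"] by (simp add: g0_def ip_abs ip_scale_right)
  moreover have "ip V g0 (adj g0) \<le> lam * ip V g0 g0"
    using le by (simp add: form_le_def supported_def)
  ultimately have eig0: "adj g0 v = lam * g0 v" if "v \<in> V" for v
    using extremal_is_eigenvector[OF le _ that] by simp
  have "ip V (f 0) (f 0) = 1" using f k by (simp add: orthonormal_on_def)
  then have "\<exists>v\<in>V. f 0 v \<noteq> 0" by (rule contrapos_pp) (simp add: ip_def)
  then have pos0: "ip V g0 (\<lambda>_. 1) > 0"
    unfolding ip_def using finite_V by (auto simp: g0_def absf_def intro!: sum_pos2)
  define c where "c i = ip V (f i) g0" for i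
  \<comment> \<open>Gram-Schmidt: the part of \<open>g0\<close> orthogonal to the relations. It is
    nonzero because \<open>g0\<close> has positive sum and the relations have sum zero.\<close>
  define g where "g v = g0 v - (\<Sum>i<k. c i * f i v)" for v
  have ipg: "ip V g z = ip V g0 z - (\<Sum>i<k. c i * ip V (f i) z)" for z
    unfolding g_def by (simp add: ip_diff_left ip_sum_left ip_scale_left)
  have fg: "ip V (f j) g = 0" if "j < k" for j
  proof -
    have "(\<Sum>i<k. c i * ip V (f i) (f j)) = (\<Sum>i<k. if i = j then c i else 0)"
      using f that by (intro sum.cong) (auto simp: orthonormal_on_def)
    then show ?thesis
      using that by (subst ip_commute) (simp add: ipg ip_commute[of V g0] c_def)
  qed
  have "ip V g (\<lambda>_. 1) > 0" using pos0 orth1 by (simp add: ipg)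
  then have "\<exists>v\<in>V. g v \<noteq> 0" by (rule contrapos_pp) (simp add: ip_def)
  then obtain w where "w \<in> V" "g w \<noteq> 0" by blast
  then have "ip V g g > 0" by (rule ip_self_pos[OF finite_V])
  note ext = orthonormal_on_extend[OF f(1) this fg]
  have adjg: "adj g v = lam * g v" if "v \<in> V" for v
  proof -
    have "adj g v = adj g0 v - adj (\<lambda>v. \<Sum>i<k. c i * f i v) v"
      by (simp add: g_def adj_def sum_subtractf)
    also have "adj (\<lambda>v. \<Sum>i<k. c i * f i v) v = (\<Sum>i<k. c i * adj (f i) v)"
      by (rule adj_sum)
    also have "\<dots> = lam * (\<Sum>i<k. c i * f i v)"
      unfolding sum_distrib_left using eig that by (intro sum.cong) auto
    also have "adj g0 v - lam * (\<Sum>i<k. c i * f i v) = lam * g v"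
      unfolding g_def eig0[OF that] by (rule right_diff_distrib[symmetric])
    finally show ?thesis .
  qed
  let ?f = "f(k := (\<lambda>v. inverse (sqrt (ip V g g)) * g v))"
  have "adj (?f i) v = lam * ?f i v" if "i < Suc k" "v \<in> V" for i v
  proof (cases "i = k")
    case True
    have "adj (\<lambda>v. inverse (sqrt (ip V g g)) * g v) v = inverse (sqrt (ip V g g)) * adj g v"
      by (simp add: adj_def sum_distrib_left)
    then show ?thesis using True adjg[OF that(2)] by simp
  next
    case False
    then show ?thesis using eig[of i v] that by simp
  qed
  with ext have "eigenfamily (Suc k) ?f" by (simp add: eigenfamily_def)
  from eigenfamily_bound[OF this le] show ?thesis by (simp add: algebra_simps)
qed

section \<open>Cliques and degrees from test vectors\<close>

lemma ip_indicator_set: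
  assumes "S \<subseteq> V"
  shows "ip V (indicator S) y = sum y S" "ip V y (indicator S) = sum y S"
proof -
  have "(\<Sum>v\<in>V. indicator S v * y v) = (\<Sum>v\<in>V. if v \<in> S then y v else 0)"
    by (rule sum.cong) auto
  also have "\<dots> = sum y (V \<inter> S)"
    using fin_V by (rule sum.inter_restrict[symmetric])
  finally have "(\<Sum>v\<in>V. indicator S v * y v) = sum y (V \<inter> S)" .
  then show "ip V (indicator S) y = sum y S"
    using assms by (simp add: ip_def Int_absorb1)
  then show "ip V y (indicator S) = sum y S"
    by (subst ip_commute)
qed

lemma adj_indicator: "adj (indicator S) v = card (nb v \<inter> S)"
  unfolding adj_def by (simp add: sum_indicator_card)

text \<open>The sum of the vectors in \<open>C\<close> has nonnegative square norm.\<close>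

lemma card_negative_clique:
  assumes C: "C \<subseteq> V" "\<And>u v. u \<in> C \<Longrightarrow> v \<in> C \<Longrightarrow> u \<noteq> v \<Longrightarrow> neg u v" "C \<noteq> {}"
  shows "(real (card C) - 1) * \<alpha> \<le> 1"
proof -
  define T where "T = real (card C)"
  have fin: "finite C" using C fin_V finite_subset by blast
  then have T: "T > 0" using C(3) by (simp add: T_def card_gt_0_iff)
  have "adj (indicator C) v = T - 1" if "v \<in> C" for v
  proof -
    have "nb v \<inter> C = C - {v}" using C(2)[OF that] E_irrefl by (auto simp: nb_def)
    then have "adj (indicator C) v = card (C - {v})" by (simp add: adj_indicator)
    moreover have "Suc (card (C - {v})) = card C" using that fin by (rule card_Suc_Diff1[rotated])
    ultimately show ?thesis unfolding T_def by linarith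
  qed
  then have "ip V (indicator C) (adj (indicator C)) = T * (T - 1)"
    using C by (simp add: ip_indicator_set T_def)
  moreover have "ip V (indicator C) (indicator C) = T" "ip V (indicator C) (\<lambda>_. 1) = T"
    using C by (simp_all add: ip_indicator_set T_def)
  ultimately have "2 * \<alpha> * (T * (T - 1)) \<le> 2 * \<alpha> * (lam * T) + \<alpha> * T\<^sup>2"
    using form_bound[of "indicator C"] by simp
  also have "2 * \<alpha> * (lam * T) = (1 - \<alpha>) * T" by (simp flip: lam_eq)
  finally have "T * ((T - 1) * \<alpha>) \<le> T * 1" by (simp add: power2_eq_square algebra_simps)
  then show ?thesis using T by (simp add: T_def)
qed

lemma exists_positive_clique:
  assumes n: "2 ^ (L + T) \<le> card V" and T: "(real T - 1) * \<alpha> > 1"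
  shows "\<exists>C\<subseteq>V. card C = L \<and> (\<forall>u\<in>C. \<forall>v\<in>C. \<not> neg u v)"
proof -
  have "(\<exists>C\<subseteq>V. card C = L \<and> pairwise (\<lambda>u v. \<not> neg u v) C) \<or>
      (\<exists>C\<subseteq>V. card C = T \<and> pairwise (\<lambda>u v. \<not> \<not> neg u v) C)"
    by (rule ramsey_two_colour[OF _ fin_V n]) (blast intro: E_sym)
  then show ?thesis
  proof
    assume "\<exists>C\<subseteq>V. card C = T \<and> pairwise (\<lambda>u v. \<not> \<not> neg u v) C"
    then obtain C where C: "C \<subseteq> V" "card C = T" "pairwise (\<lambda>u v. neg u v) C" by auto
    have "C \<noteq> {}" using C(2) T \<alpha>_pos by auto
    with card_negative_clique[of C] C T show ?thesis by (auto simp: pairwise_def)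
  next
    assume "\<exists>C\<subseteq>V. card C = L \<and> pairwise (\<lambda>u v. \<not> neg u v) C"
    then obtain C where C: "C \<subseteq> V" "card C = L" "pairwise (\<lambda>u v. \<not> neg u v) C" by blast
    have "\<not> neg u v" if "u \<in> C" "v \<in> C" for u v
      using pairwiseD[OF C(3) that] E_irrefl by blast
    then show ?thesis using C by blast
  qed
qed

text \<open>The vector \<open>w\<close> from the mean over \<open>B\<close> to the mean over
  \<open>A\<close> is short if both sets are large, but \<open>x v\<close> has inner product
  \<open>2 * \<alpha>\<close> with it.\<close>

lemma clique_split:
  assumes C: "C \<subseteq> V" "\<forall>u\<in>C. \<forall>v\<in>C. \<not> neg u v" and v: "v \<in> V - C"
  shows "card (nb v \<inter> C) \<le> (1 - \<alpha>) / (2 * \<alpha>\<^sup>2) \<or> card (C - nb v) \<le> (1 - \<alpha>) / (2 * \<alpha>\<^sup>2)"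
proof (rule ccontr)
  define \<kappa> where "\<kappa> = (1 - \<alpha>) / (2 * \<alpha>\<^sup>2)"
  have \<kappa>: "\<kappa> > 0" using \<alpha>_pos \<alpha>_less by (simp add: \<kappa>_def)
  define A B where "A = C - nb v" and "B = nb v \<inter> C"
  define a b where "a = real (card A)" and "b = real (card B)"
  assume "\<not> ?thesis"
  then have ab: "a > \<kappa>" "b > \<kappa>" by (simp_all add: a_def b_def A_def B_def \<kappa>_def not_le)
  then have ab0: "a > 0" "b > 0" using \<kappa> by auto
  have sub: "A \<subseteq> V" "B \<subseteq> V" "A \<inter> B = {}" "A \<subseteq> C" "B \<subseteq> C" using C by (auto simp: A_def B_def)
  define y :: "'a \<Rightarrow> real" where "y = (\<lambda>u. inverse a * indicator A u + (- inverse b) * indicator B u)"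
  have "ip V y y = inverse a * inverse a * a + inverse b * inverse b * b"
    unfolding y_def ip_lin_left ip_lin_right using sub
    by (simp add: ip_indicator_set a_def b_def sum_indicator_card Int_commute[of B A]
        finite_subset[OF sub(1) fin_V] finite_subset[OF sub(2) fin_V])
  then have yy: "ip V y y = inverse a + inverse b" using ab0 by (simp add: mult.assoc)
  have "nb u \<inter> A = {}" "nb u \<inter> B = {}" if "u \<in> C" for u
    using C(2) that sub by (auto simp: nb_def)
  then have adj0: "adj y u = 0" if "u \<in> C" for u
    unfolding y_def using that by (simp only: adj_lin adj_indicator) simp
  have "ip V y (adj y) = 0"
    unfolding ip_def by (rule sum.neutral) (use adj0 sub in \<open>auto simp: y_def indicator_def\<close>)
  moreover have "ip V y (\<lambda>_. 1) = 0"
    unfolding y_def ip_lin_left using sub ab0 by (simp add: ip_indicator_set a_def b_def)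
  moreover define w where "w = (\<Sum>u\<in>V. y u *\<^sub>R x u)"
  ultimately have ww: "w \<bullet> w = (1 - \<alpha>) * (inverse a + inverse b)"
    using norm_combination[of y] by (simp add: yy)
  have "adj y v = - 1"
  proof -
    have "nb v \<inter> A = {}" "nb v \<inter> B = B" by (auto simp: A_def B_def)
    then have "adj y v = - inverse b * b"
      unfolding y_def by (simp only: adj_lin adj_indicator) (simp add: b_def)
    then show ?thesis using ab0 by simp
  qed
  moreover have "y v = 0" using v sub by (auto simp: y_def indicator_def)
  ultimately have wv: "w \<bullet> x v = 2 * \<alpha>"
    using inner_combination[of v y] v \<open>ip V y (\<lambda>_. 1) = 0\<close> by (simp add: w_def)
  have "(w \<bullet> x v)\<^sup>2 \<le> (w \<bullet> w) * (x v \<bullet> x v)" by (rule Cauchy_Schwarz_ineq)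
  then have "4 * \<alpha>\<^sup>2 \<le> (1 - \<alpha>) * (inverse a + inverse b)"
    using unit[of v] v by (simp add: wv ww power2_eq_square)
  also have "\<dots> < (1 - \<alpha>) * (inverse \<kappa> + inverse \<kappa>)"
    using ab \<kappa> \<alpha>_less by (intro mult_strict_left_mono add_strict_mono less_imp_inverse_less) auto
  also have "\<dots> = 2 * ((1 - \<alpha>) * inverse \<kappa>)" by simp
  also have "(1 - \<alpha>) * inverse \<kappa> = 2 * \<alpha>\<^sup>2" using \<alpha>_less by (simp add: \<kappa>_def)
  finally show False by simp
qed

text \<open>A star with \<open>t\<close> leaves has top eigenvalue \<open>sqrt t\<close>. Its
  eigenvector is made orthogonal to the constants by a negative weight spread over a far part of
  \<open>C\<close>, which at most doubles the square norm, so
  \<open>sqrt t \<le> 2 * lam\<close>.\<close>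

lemma degree_bound:
  assumes C: "C \<subseteq> V" "\<forall>u\<in>C. \<forall>v\<in>C. \<not> neg u v" "\<And>v. v \<in> V \<Longrightarrow> card (nb v \<inter> C) \<le> \<kappa>"
    and t: "real t > 4 * lam\<^sup>2" "2 * t + (t + 1) * (\<kappa> + 1) \<le> card C" and v: "v \<in> V"
  shows "card (nb v) \<le> t"
proof (rule ccontr)
  assume "\<not> ?thesis"
  then obtain Y where Y: "Y \<subseteq> nb v" "card Y = t"
    by (meson nat_le_linear obtain_subset_with_card_n)
  have t0: "t > 0" using t(1) by (cases t) auto
  have YV: "Y \<subseteq> V" using Y nb_subset by blast
  have finY: "finite Y" using YV fin_V finite_subset by blast
  have vY: "v \<notin> Y" using Y E_irrefl by (auto simp: nb_def)
  \<comment> \<open>Each of the \<open>t + 1\<close> vertices of the star excludes at most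
    \<open>\<kappa> + 1\<close> vertices of \<open>C\<close>, so at least \<open>2 * t\<close>
    remain.\<close>
  define D where "D = C - (\<Union>u\<in>insert v Y. insert u (nb u \<inter> C))"
  have finC: "finite C" using C fin_V finite_subset by blast
  have "card (\<Union>u\<in>insert v Y. insert u (nb u \<inter> C)) \<le> (\<Sum>u\<in>insert v Y. card (insert u (nb u \<inter> C)))"
    using finY by (intro card_UN_le) simp
  also have "\<dots> \<le> (\<Sum>u\<in>insert v Y. \<kappa> + 1)"
  proof (rule sum_mono)
    fix u assume "u \<in> insert v Y"
    then have "card (nb u \<inter> C) \<le> \<kappa>" using v YV C(3) by auto
    then show "card (insert u (nb u \<inter> C)) \<le> \<kappa> + 1"
      using card_insert_le_m1[of "\<kappa> + 1" "nb u \<inter> C" u] by simp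
  qed
  also have "\<dots> = (t + 1) * (\<kappa> + 1)" using finY vY Y(2) by simp
  finally have "card D \<ge> 2 * t"
    using diff_card_le_card_Diff[of "\<Union>u\<in>insert v Y. insert u (nb u \<inter> C)" C] finY t(2)
    by (simp add: D_def)
  then have D: "real (card D) \<ge> 2 * t" by linarith
  have DV: "D \<subseteq> V" "D \<subseteq> C" using C by (auto simp: D_def)
  define s where "s = sqrt (real t)"
  \<comment> \<open>The weight on \<open>D\<close> that cancels the coefficient sum
    \<open>t + s\<close> of the star vector.\<close>
  define d where "d = (t + s) / card D"
  have s: "s > 0" "s\<^sup>2 = t" "s \<le> t"
    using t0 real_sqrt_le_mono[of t "t\<^sup>2"] by (auto simp: s_def power2_eq_square)
  define y :: "'a \<Rightarrow> real" where "y = (\<lambda>u. s * indicator {v} u + 1 * indicator Y u)"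
  define z :: "'a \<Rightarrow> real" where "z = (\<lambda>u. 1 * y u + (- d) * indicator D u)"
  have finD: "finite D" using DV fin_V finite_subset by blast
  have yz: "u \<noteq> w \<and> \<not> neg u w" if "y u \<noteq> 0" "indicator D w \<noteq> (0::real)" for u w
    using that by (auto simp: y_def D_def indicator_def nb_def split: if_splits)
  note sep = separated_ip[of y "indicator D", OF yz]
  have nvY: "nb v \<inter> Y = Y" using Y by auto
  have "ip V y (adj y) = s * (s * adj (indicator {v}) v + adj (indicator Y) v)
      + (s * ip V (indicator Y) (adj (indicator {v})) + ip V (indicator Y) (adj (indicator Y)))"
  proof -
    have "adj y = (\<lambda>u. s * adj (indicator {v}) u + 1 * adj (indicator Y) u)"
      unfolding y_def by (rule ext) (rule adj_lin)
    then show ?thesis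
      unfolding y_def using v fin_V by (simp only: ip_lin_left ip_lin_right) (simp add: ip_indicator)
  qed
  moreover have "ip V (indicator Y) (adj (indicator {v})) = t"
    using v fin_V nvY by (simp add: ip_adj_commute ip_indicator adj_indicator Y)
  moreover have "0 \<le> ip V (indicator Y) (adj (indicator Y))"
    using YV by (simp add: ip_indicator_set adj_indicator sum_nonneg)
  moreover have "0 \<le> s * (s * adj (indicator {v}) v)"
    using s by (simp add: adj_indicator)
  moreover have "adj (indicator Y) v = t" using nvY Y by (simp add: adj_indicator)
  ultimately have yAy: "2 * t * s \<le> ip V y (adj y)" by (simp add: algebra_simps)
  have yy: "ip V y y = 2 * t"
    unfolding y_def using v YV fin_V vY s finY Y(2)
    by (simp only: ip_lin_left ip_lin_right)
      (simp add: ip_indicator ip_indicator_set sum_indicator_card power2_eq_square)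
  have y1: "ip V y (\<lambda>_. 1) = t + s"
    unfolding y_def ip_lin_left using v YV fin_V Y(2) by (simp add: ip_indicator ip_indicator_set)
  have "adj (indicator D) u = 0" if "u \<in> D" for u
  proof -
    have "nb u \<inter> D = {}" using that DV C(2) unfolding nb_def by blast
    then show ?thesis by (simp add: adj_indicator)
  qed
  then have DAD: "ip V (indicator D) (adj (indicator D)) = 0"
    using DV by (simp add: ip_indicator_set)
  have DD: "ip V (indicator D) (indicator D) = card D" "ip V (indicator D) (\<lambda>_. 1) = card D"
    using DV by (simp_all add: ip_indicator_set)
  have adjz: "adj z = (\<lambda>u. 1 * adj y u + (- d) * adj (indicator D) u)"
    unfolding z_def by (rule ext) (rule adj_lin)
  have D0: "real (card D) > 0" using D t0 by linarith
  have "ip V z (\<lambda>_. 1) = 0"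
    unfolding z_def ip_lin_left using D0 by (simp add: y1 DD d_def)
  then have "ip V z (adj z) \<le> lam * ip V z z"
    using orthogonal_form by (simp add: orthogonal_form_le_def)
  also have "ip V z (adj z) = ip V y (adj y)"
    unfolding adjz unfolding z_def ip_lin_left ip_lin_right by (simp add: sep DAD)
  also have "ip V z z = 2 * t + d\<^sup>2 * card D"
    unfolding z_def ip_lin_left ip_lin_right by (simp add: sep DD yy power2_eq_square)
  finally have "2 * t * s \<le> lam * (2 * t + d\<^sup>2 * card D)" using yAy by linarith
  also have "d\<^sup>2 * card D \<le> 2 * t"
  proof -
    have "d\<^sup>2 * card D = (t + s)\<^sup>2 / card D" using D0 by (simp add: d_def power2_eq_square)
    also have "(t + s)\<^sup>2 \<le> (2 * real t)\<^sup>2" using s by (intro power_mono) auto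
    then have "(t + s)\<^sup>2 / card D \<le> (2 * t)\<^sup>2 / (2 * t)"
      using D t0 D0 by (intro frac_le) auto
    also have "\<dots> = 2 * t" using t0 by (simp add: power2_eq_square)
    finally show ?thesis .
  qed
  finally have "2 * t * s \<le> 2 * t * (2 * lam)" using lam_pos by (simp add: algebra_simps)
  then have "s \<le> 2 * lam" using t0 by simp
  then have "s\<^sup>2 \<le> (2 * lam)\<^sup>2" using s by (intro power_mono) auto
  then show False using s t(1) by (simp add: power_mult_distrib)
qed

end

subsection \<open>Bounded degree and the size of the parameters\<close>

lemma le_two_powr: "b \<le> 2 powr (2 * b)" for b :: real
proof (cases "b \<ge> 0")
  case True
  have "1 + b \<le> exp b" by (rule exp_ge_add_one_self)
  also have "b \<le> 2 * b * ln 2"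
    using ln2_ge_two_thirds True mult_left_mono[of "1 / 2" "ln 2" "2 * b"] by simp
  then have "exp b \<le> 2 powr (2 * b)" by (simp add: powr_def)
  finally show ?thesis by simp
next
  case False
  then have "b \<le> 0" by simp
  then show ?thesis by (rule order.trans) simp
qed

lemma nat_ceiling_bounds:
  fixes y :: real
  assumes "y \<ge> 0"
  shows "y \<le> real (nat \<lceil>y\<rceil>)" "real (nat \<lceil>y\<rceil>) \<le> y + 1"
  using assms by linarith+

lemma nat_floor_bounds:
  fixes y :: real
  assumes "y \<ge> 0"
  shows "real (nat \<lfloor>y\<rfloor>) \<le> y" "y < real (nat \<lfloor>y\<rfloor>) + 1"
  using assms by linarith+

text \<open>With \<open>b = 1 / \<alpha>\<close> the Ramsey exponent is only of order
  \<open>b ^ 4\<close>.\<close>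

lemma ramsey_size_bound:
  fixes b n :: real and t \<kappa> T :: nat
  assumes b: "b \<ge> 2" and n: "n \<ge> 2 powr (b ^ 20)"
    and t: "t \<le> b\<^sup>2" and \<kappa>: "\<kappa> + 1 \<le> b\<^sup>2" and T: "T \<le> b + 3"
  shows "2 ^ (2 * t + (t + 1) * (\<kappa> + 1) + T) \<le> n"
proof -
  have "real (2 * t + (t + 1) * (\<kappa> + 1) + T) = 2 * t + (real t + 1) * (real \<kappa> + 1) + T"
    by (simp add: algebra_simps)
  also have "\<dots> \<le> 2 * b\<^sup>2 + (b\<^sup>2 + 1) * b\<^sup>2 + (b + 3)"
    using t \<kappa> T by (intro add_mono mult_mono) auto
  also have "\<dots> = b ^ 4 + 3 * b ^ 2 + b ^ 1 + 3 * b ^ 0" by (simp add: power_numeral_reduce algebra_simps)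
  also have "\<dots> \<le> b ^ 4 + 3 * b ^ 4 + b ^ 4 + 3 * b ^ 4"
    using b by (intro add_mono mult_left_mono power_increasing) auto
  also have "\<dots> = b ^ 4 * 2 ^ 3" by simp
  also have "\<dots> \<le> b ^ 4 * b ^ 16"
    using b order.trans[OF power_mono[of 2 b 3] power_increasing[of 3 16 b]]
    by (intro mult_left_mono) auto
  also have "\<dots> = b ^ 20" by (simp flip: power_add)
  finally have "2 powr real (2 * t + (t + 1) * (\<kappa> + 1) + T) \<le> n"
    using n by (meson order.trans powr_mono one_le_numeral)
  then show ?thesis by (subst (asm) powr_realpow) auto
qed

text \<open>The ball has size \<open>2\<close> to a power of order \<open>b ^ 8\<close>; the
  remaining factor \<open>b ^ 12 \<ge> 2 ^ 12\<close> absorbs the constant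
  \<open>3138 = 6 * (2 * 258 + 7)\<close> and the lower terms.\<close>

lemma ball_size_bound:
  fixes b n :: real and t m :: nat
  assumes b: "b \<ge> 2" and n: "n \<ge> 2 powr (b ^ 20)"
    and t: "t \<le> b\<^sup>2" and m: "m \<le> 258 * b ^ 7"
  shows "(real t + 1) ^ (2 * m + 7) + 2 \<le> n / ((b + 1) * (b + 2))"
proof -
  have b8: "1 \<le> b ^ 7" "1 \<le> b ^ 8" "b \<le> b ^ 8" "b \<le> 2 powr (2 * b)"
    using b power_increasing[of 1 8 b] le_two_powr[of b] by (auto intro: one_le_power)
  have "real t + 1 \<le> b\<^sup>2 + b\<^sup>2 * 1"
    using t b one_le_power[of b 2] by linarith
  also have "\<dots> = b\<^sup>2 * 2" by simp
  also have "\<dots> \<le> b\<^sup>2 * b" using b by (intro mult_left_mono) auto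
  also have "\<dots> = b ^ 3" by (simp add: power_numeral_reduce)
  also have "\<dots> \<le> (2 powr (2 * b)) ^ 3" using b b8 by (intro power_mono) auto
  also have "\<dots> = 2 powr (6 * b)" by (simp add: powr_power)
  finally have "(real t + 1) ^ (2 * m + 7) \<le> (2 powr (6 * b)) ^ (2 * m + 7)"
    by (intro power_mono) auto
  also have "\<dots> = 2 powr (6 * b * (2 * m + 7))" by (simp add: powr_power mult.commute)
  also have "\<dots> \<le> 2 powr (3138 * b ^ 8)"
  proof -
    have "2 * real m + 7 \<le> 2 * (258 * b ^ 7) + 7 * b ^ 7" using m b8(1) by linarith
    then have "6 * b * (2 * m + 7) \<le> 6 * b * (2 * (258 * b ^ 7) + 7 * b ^ 7)"
      using b by (intro mult_left_mono) auto
    also have "\<dots> = 3138 * b ^ 8" by (simp add: power_numeral_reduce)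
    finally show ?thesis by (intro powr_mono) auto
  qed
  finally have A: "(real t + 1) ^ (2 * m + 7) \<le> 2 powr (3138 * b ^ 8)" .
  have "2 powr 1 \<le> 2 powr (3138 * b ^ 8)" using b8 by (intro powr_mono) auto
  with A have B: "(real t + 1) ^ (2 * m + 7) + 2 \<le> 2 powr (3138 * b ^ 8 + 1)"
    by (simp add: powr_add)
  have "(b + 1) * (b + 2) \<le> (2 * b) * (2 * b)" using b by (intro mult_mono) auto
  also have "\<dots> = 4 * (b * b)" by simp
  also have "\<dots> \<le> 4 * (2 powr (2 * b) * 2 powr (2 * b))"
    using b b8 by (intro mult_left_mono mult_mono) auto
  also have "\<dots> = 2 powr 2 * (2 powr (2 * b) * 2 powr (2 * b))" by simp
  also have "\<dots> = 2 powr (2 + 4 * b)" by (simp only: powr_add[symmetric]) simp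
  finally have C: "(b + 1) * (b + 2) \<le> 2 powr (2 + 4 * b)" .
  have "((real t + 1) ^ (2 * m + 7) + 2) * ((b + 1) * (b + 2))
      \<le> 2 powr (3138 * b ^ 8 + 1) * 2 powr (2 + 4 * b)"
    using B C b by (intro mult_mono) auto
  also have "\<dots> = 2 powr (3138 * b ^ 8 + 1 + (2 + 4 * b))" by (simp only: powr_add)
  also have "\<dots> \<le> 2 powr (b ^ 20)"
  proof (rule powr_mono)
    have "3138 * b ^ 8 + 1 + (2 + 4 * b) \<le> 2 ^ 12 * b ^ 8" using b8 by simp
    also have "\<dots> \<le> b ^ 12 * b ^ 8" using b by (intro mult_right_mono power_mono) auto
    also have "\<dots> = b ^ 20" by (simp flip: power_add)
    finally show "3138 * b ^ 8 + 1 + (2 + 4 * b) \<le> b ^ 20" .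
  qed simp
  also note n
  finally have "((real t + 1) ^ (2 * m + 7) + 2) * ((b + 1) * (b + 2)) \<le> n" .
  moreover have "0 < (b + 1) * (b + 2)" using b by simp
  ultimately show ?thesis by (simp only: pos_le_divide_eq)
qed

section \<open>Switching and the bound on the number of vectors\<close>

context equiangular_vectors
begin

lemma switching:
  assumes "\<And>v. s v = 1 \<or> s v = (-1 :: real)"
  shows "equiangular_vectors V (\<lambda>v. s v *\<^sub>R x v) \<alpha>"
proof
  fix u v
  show "u \<in> V \<Longrightarrow> (s u *\<^sub>R x u) \<bullet> (s u *\<^sub>R x u) = 1"
    and "u \<in> V \<Longrightarrow> v \<in> V \<Longrightarrow> u \<noteq> v \<Longrightarrow> \<bar>(s u *\<^sub>R x u) \<bullet> (s v *\<^sub>R x v)\<bar> = \<alpha>"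
    using assms[of u] assms[of v] unit[of u] equi[of u v] by auto
qed (use fin_V \<alpha>_pos \<alpha>_less in auto)

lemma card_bound_if_form_le:
  assumes "form_le UNIV"
  shows "card V \<le> DIM('b) \<or> lam * card V \<le> (1 + lam) * (real DIM('b) - 1)"
proof (cases "card V \<le> DIM('b)")
  case False
  define k where "k = card V - DIM('b)"
  have k: "k + DIM('b) = card V" "k > 0" using False by (simp_all add: k_def)
  then have "real k = real (card V) - real DIM('b)" by linarith
  with bound_if_form_le[OF assms k]
  have "(real (card V) - real DIM('b) + 1) * (1 + lam) \<le> card V" by simp
  then show ?thesis by (simp add: algebra_simps)
qed simp

text \<open>Switch so that all vectors have positive inner product with one of them. A negative pair
  would make the vector \<open>x' u + x' w - x' v0\<close> have square norm
  \<open>3 - 6 * \<alpha> < 0\<close>, so the graph is empty.\<close>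

lemma card_bound_large_angle:
  assumes "\<alpha> > 1 / 2"
  shows "card V \<le> DIM('b) \<or> lam * card V \<le> (1 + lam) * (real DIM('b) - 1)"
proof (cases "V = {}")
  case False
  then obtain v0 where v0: "v0 \<in> V" by blast
  define s where "s v = (if x v \<bullet> x v0 < 0 then -1 else 1 :: real)" for v
  define x' where "x' v = s v *\<^sub>R x v" for v
  interpret S: equiangular_vectors V x' \<alpha>
    using switching[of s] by (simp add: s_def x'_def[abs_def])
  have pos: "x' v \<bullet> x' v0 = \<alpha>" if "v \<in> V" "v \<noteq> v0" for v
    using equi[OF that(1) v0 that(2)] unit[OF v0] by (auto simp: x'_def s_def)
  have no: "\<not> S.neg u w" for u w
  proof
    assume "S.neg u w"
    then have uw: "u \<in> V" "w \<in> V" "u \<noteq> w" "x' u \<bullet> x' w = - \<alpha>" by (auto simp: S.neg_def)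
    then have ne: "u \<noteq> v0" "w \<noteq> v0"
      using pos[of u] pos[of w] \<alpha>_pos inner_commute[of "x' u" "x' w"] by auto
    then have p: "x' u \<bullet> x' v0 = \<alpha>" "x' w \<bullet> x' v0 = \<alpha>"
      using pos uw by blast+
    then have p': "x' v0 \<bullet> x' u = \<alpha>" "x' v0 \<bullet> x' w = \<alpha>" "x' w \<bullet> x' u = - \<alpha>"
      using uw(4) by (metis inner_commute)+
    have "0 \<le> (x' u + x' w - x' v0) \<bullet> (x' u + x' w - x' v0)" by simp
    also have "\<dots> = 3 - 6 * \<alpha>"
      using S.unit[OF uw(1)] S.unit[OF uw(2)] S.unit[OF v0]
      by (simp add: inner_add_left inner_add_right inner_diff_left inner_diff_right p p' uw(4))
    finally show False using assms by simp
  qed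
  then have "S.adj y v = 0" for y v by (simp add: S.adj_def S.nb_def)
  then have "S.form_le UNIV"
    using lam_pos by (simp add: S.form_le_def ip_def mult_nonneg_nonneg sum_nonneg)
  from S.card_bound_if_form_le[OF this] show ?thesis .
qed simp

lemma exists_bounded_degree_switching:
  assumes \<alpha>: "\<alpha> \<le> 1 / 2" and n: "card V \<ge> 2 powr ((1 / \<alpha>) ^ 20)"
  shows "\<exists>(x' :: 'a \<Rightarrow> 'b) t. equiangular_vectors V x' \<alpha> \<and> real t \<le> (1 / \<alpha>)\<^sup>2 \<and>
    (\<forall>v\<in>V. card (weighted_graph.nb (equiangular_vectors.neg V x' \<alpha>) v) \<le> t)"
proof -
  define b where "b = 1 / \<alpha>"
  have b: "b \<ge> 2" using \<alpha> \<alpha>_pos by (simp add: b_def field_simps)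
  have lam: "2 * lam = b - 1" using \<alpha>_pos by (simp add: lam_def b_def field_simps)
  define t where "t = nat \<lfloor>4 * lam\<^sup>2\<rfloor> + 1"
  define K where "K = (1 - \<alpha>) / (2 * \<alpha>\<^sup>2)"
  define \<kappa> where "\<kappa> = nat \<lfloor>K\<rfloor>"
  \<comment> \<open>Just large enough that a negative clique of size \<open>T\<close> is impossible;
    \<open>L\<close> is the clique size that \<open>degree_bound\<close> asks for.\<close>
  define T where "T = nat \<lceil>b\<rceil> + 2"
  define L where "L = 2 * t + (t + 1) * (\<kappa> + 1)"
  have K: "2 * K = b\<^sup>2 - b" using \<alpha>_pos by (simp add: K_def b_def power2_eq_square field_simps)
  have K0: "K \<ge> 0" using \<alpha>_pos \<alpha>_less by (simp add: K_def)
  have b2: "b\<^sup>2 \<ge> 2 * b" using b by (simp add: power2_eq_square)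
  have lam4: "4 * lam\<^sup>2 = (b - 1)\<^sup>2" by (simp add: power2_eq_square flip: lam)
  have t: "real t > 4 * lam\<^sup>2" "real t \<le> b\<^sup>2"
  proof -
    have eq: "real t = real (nat \<lfloor>4 * lam\<^sup>2\<rfloor>) + 1" by (simp only: t_def of_nat_add of_nat_1)
    have nonneg: "0 \<le> 4 * lam\<^sup>2" by simp
    show "real t > 4 * lam\<^sup>2" unfolding eq by (rule nat_floor_bounds(2)[OF nonneg])
    have "real t \<le> (b - 1)\<^sup>2 + 1"
      using nat_floor_bounds(1)[OF nonneg] unfolding eq lam4 by simp
    then show "real t \<le> b\<^sup>2" using b by (simp add: power2_eq_square algebra_simps)
  qed
  have \<kappa>: "real \<kappa> \<le> K" "\<And>j. real j \<le> K \<Longrightarrow> j \<le> \<kappa>"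
    using nat_floor_bounds[OF K0] by (auto simp: \<kappa>_def le_nat_floor)
  have "real \<kappa> + 1 \<le> b\<^sup>2" using \<kappa>(1) K b b2 by linarith
  moreover have T: "real T = real (nat \<lceil>b\<rceil>) + 2" by (simp only: T_def of_nat_add of_nat_numeral)
  then have "real T \<le> b + 3" using nat_ceiling_bounds(2)[of b] b by linarith
  ultimately have "real (2 ^ (L + T)) \<le> real (card V)"
    using ramsey_size_bound[OF b n[folded b_def] t(2)] by (simp add: L_def)
  then have n2: "2 ^ (L + T) \<le> card V" by (simp only: of_nat_le_iff)
  have "(b + 1) * \<alpha> \<le> (real T - 1) * \<alpha>"
    using nat_ceiling_bounds(1)[of b] b \<alpha>_pos by (intro mult_right_mono) (auto simp: T)
  moreover have "(b + 1) * \<alpha> = 1 + \<alpha>" using \<alpha>_pos by (simp add: b_def field_simps)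
  ultimately have "(real T - 1) * \<alpha> > 1" using \<alpha>_pos by linarith
  from exists_positive_clique[OF n2 this] obtain C
    where C: "C \<subseteq> V" "card C = L" "\<forall>u\<in>C. \<forall>v\<in>C. \<not> neg u v" by blast
  \<comment> \<open>Negate the vertices with many neighbours in \<open>C\<close>: by
    \<open>clique_split\<close> they have few non-neighbours there, and these become the
    neighbours.\<close>
  define s where "s v = (if v \<in> V - C \<and> \<kappa> < card (nb v \<inter> C) then -1 else 1 :: real)" for v
  define x' where "x' v = s v *\<^sub>R x v" for v
  interpret S: equiangular_vectors V x' \<alpha>
    using switching[of s] by (simp add: s_def x'_def[abs_def])
  have sC: "s v = 1" if "v \<in> C" for v using that by (simp add: s_def)
  have CC: "\<forall>u\<in>C. \<forall>v\<in>C. \<not> S.neg u v"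
    using C(3) by (simp add: S.neg_def neg_def x'_def sC)
  have deg: "card (S.nb v \<inter> C) \<le> \<kappa>" if v: "v \<in> V" for v
  proof (cases "v \<in> C")
    case True
    then have "S.nb v \<inter> C = {}" using CC unfolding S.nb_def by blast
    then show ?thesis by simp
  next
    case vC: False
    show ?thesis
    proof (cases "\<kappa> < card (nb v \<inter> C)")
      case True
      then have "\<not> real (card (nb v \<inter> C)) \<le> K" using \<kappa>(2) by (meson not_le)
      then have "real (card (C - nb v)) \<le> K"
        using clique_split[OF C(1,3), of v] v vC unfolding K_def by blast
      moreover have "S.nb v \<inter> C \<subseteq> C - nb v"
      proof
        fix u assume u: "u \<in> S.nb v \<inter> C"
        then have "- (x v \<bullet> x u) = - \<alpha>"
          using vC v True by (auto simp: S.nb_def S.neg_def x'_def sC) (simp add: s_def)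
        then show "u \<in> C - nb v" using u \<alpha>_pos by (auto simp: nb_def neg_def)
      qed
      moreover have "finite C" using C fin_V finite_subset by blast
      ultimately show ?thesis using \<kappa>(2) by (meson card_mono finite_Diff order.trans)
    next
      case False
      then have "s v = 1" by (simp add: s_def)
      then have "S.nb v \<inter> C = nb v \<inter> C"
        by (auto simp: S.nb_def S.neg_def nb_def neg_def x'_def sC)
      then show ?thesis using False by simp
    qed
  qed
  have "card (S.nb v) \<le> t" if "v \<in> V" for v
    by (rule S.degree_bound[OF C(1) CC deg t(1) _ that]) (auto simp: C L_def)
  then show ?thesis using S.equiangular_vectors_axioms t(2) unfolding b_def by blast
qed

lemma card_bound_bounded_degree:
  assumes \<alpha>: "\<alpha> \<le> 1 / 2" and n: "card V \<ge> 2 powr ((1 / \<alpha>) ^ 20)"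
    and deg: "\<And>v. v \<in> V \<Longrightarrow> card (nb v) \<le> t" and t: "real t \<le> (1 / \<alpha>)\<^sup>2"
  shows "card V \<le> DIM('b) \<or> lam * card V \<le> (1 + lam) * (real DIM('b) - 1)"
proof (cases "form_le UNIV \<or> card V \<le> DIM('b)")
  case True
  then show ?thesis using card_bound_if_form_le by blast
next
  case False
  define b where "b = 1 / \<alpha>"
  have b: "b \<ge> 2" using \<alpha> \<alpha>_pos by (simp add: b_def field_simps)
  have lam: "2 * lam = b - 1" using \<alpha>_pos by (simp add: lam_def b_def field_simps)
  have b_eq: "b = 2 * lam + 1" using lam by simp
  define P Q where "P = lam + 1" and "Q = lam + 3 / 2"
  have PQ: "P > 0" "Q > 0" "Q = P + 1 / 2" "4 * (P * Q) = (b + 1) * (b + 2)" "2 * Q = b + 2"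
    using lam_pos by (simp_all add: P_def Q_def b_eq algebra_simps)
  define m where "m = 2 * nat \<lceil>(b + 2) ^ 7\<rceil>"
  \<comment> \<open>The gap \<open>Q - P = 1 / 2\<close> is shared out: 1/4 for the ball, 1/8 for
    \<open>\<tau>\<close> and 1/8 for \<open>\<epsilon>\<close>. The choice of \<open>m\<close> is
    what the product \<open>\<epsilon> * \<tau>\<close> then requires.\<close>
  define \<epsilon> \<tau> where "\<epsilon> = 1 / (8 * P)" and "\<tau> = 1 / (8 * (P * Q))"
  have m_ge: "(b + 2) ^ 7 \<le> m" and m_le: "m \<le> 258 * b ^ 7"
  proof -
    have "0 \<le> (b + 2) ^ 7" using b by simp
    note ceil = nat_ceiling_bounds[OF this]
    show "(b + 2) ^ 7 \<le> m" using ceil by (simp add: m_def)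
    have "(b + 2) ^ 7 \<le> (2 * b) ^ 7" using b by (intro power_mono) auto
    moreover have "1 \<le> b ^ 7" using b by (simp add: one_le_power)
    ultimately show "m \<le> 258 * b ^ 7" using ceil by (simp add: m_def power_mult_distrib)
  qed
  define n where "n = real (card V)"
  \<comment> \<open>The condition of coefficient sum zero costs one dimension; the summand 2 in
    \<open>ball_size_bound\<close> makes up for it and leads to
    \<open>k + 2 = card V - DIM('b) + 1\<close>.\<close>
  define k where "k = card V - DIM('b) - 1"
  have k: "k + DIM('b) + 1 = card V" using False by (simp add: k_def)
  then obtain f where f: "eigenfamily k f" using exists_eigenfamily[of k] by auto
  have "0 < (b + 2) ^ 7" using b by simp
  with m_ge have "0 < real m" by linarith
  then have "0 < m" by simp
  moreover have "2 * lam\<^sup>2 * (lam + 1)\<^sup>2 \<le> \<epsilon> * \<tau> * m"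
  proof -
    have "(2 * lam\<^sup>2 * P\<^sup>2) * (64 * (P\<^sup>2 * Q)) = 128 * (lam\<^sup>2 * P ^ 4 * Q)"
      by (simp add: power_numeral_reduce)
    also have "\<dots> \<le> 128 * (Q\<^sup>2 * Q ^ 4 * Q)"
      using lam_pos by (intro mult_left_mono mult_mono power_mono) (auto simp: P_def Q_def)
    also have "\<dots> = (2 * Q) ^ 7" by (simp add: power_numeral_reduce)
    also have "\<dots> \<le> m" unfolding PQ(5) by (rule m_ge)
    finally have "2 * lam\<^sup>2 * P\<^sup>2 \<le> m / (64 * (P\<^sup>2 * Q))" using PQ by (simp add: pos_le_divide_eq)
    also have "\<dots> = \<epsilon> * \<tau> * m" by (simp add: \<epsilon>_def \<tau>_def power2_eq_square)
    finally show ?thesis by (simp add: P_def)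
  qed
  moreover have "0 < \<epsilon>" "0 < \<tau>" using PQ by (simp_all add: \<epsilon>_def \<tau>_def)
  moreover have "\<epsilon> \<le> 1 / 2" using lam_pos by (simp add: \<epsilon>_def P_def field_simps)
  ultimately have "real k \<le> (real t + 1) ^ (2 * m + 7) + \<tau> * n + (1 + \<epsilon>) * n / Q"
    unfolding n_def Q_def using f orthogonal_form False deg
    by (intro eigenfamily_bound_with_excess[where f = f]) (auto simp: m_def)
  moreover have "(real t + 1) ^ (2 * m + 7) + 2 \<le> n / (4 * (P * Q))"
    unfolding PQ(4) n_def using t assms(2) m_le by (intro ball_size_bound[OF b]) (auto simp: b_def)
  ultimately have "real k + 2 \<le> n / (4 * (P * Q)) + \<tau> * n + (1 + \<epsilon>) * n / Q" by linarith
  also have "\<dots> = n * (1 / 4 + 1 / 8 + (1 + \<epsilon>) * P) / (P * Q)"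
    using PQ(1,2) by (simp add: \<tau>_def field_simps)
  also have "1 / 4 + 1 / 8 + (1 + \<epsilon>) * P = Q"
    unfolding PQ(3) using PQ(1) by (simp add: \<epsilon>_def field_simps)
  also have "n * Q / (P * Q) = n / P" using PQ(2) by simp
  finally have "(real k + 2) * P \<le> n" using PQ(1) by (simp add: field_simps)
  moreover have "real k = n - DIM('b) - 1" using k unfolding n_def by linarith
  ultimately have "(n - DIM('b) + 1) * P \<le> n" by (simp add: algebra_simps)
  then show ?thesis by (simp add: P_def n_def algebra_simps)
qed

theorem card_bound:
  assumes r: "DIM('b) \<ge> 2 powr (1 / \<alpha> ^ 20)"
  shows "card V \<le> (1 + 2 * \<alpha> / (1 - \<alpha>)) * (real DIM('b) - 1)"
proof -
  define n r where "n = real (card V)" and "r = real DIM('b)"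
  have r': "r \<ge> 2 powr ((1 / \<alpha>) ^ 20)" using assms by (simp add: r_def power_one_over)
  have dich: "n \<le> r \<or> lam * n \<le> (1 + lam) * (r - 1)"
  proof (cases "\<alpha> > 1 / 2 \<or> n \<le> r")
    case True
    then show ?thesis using card_bound_large_angle by (auto simp: n_def r_def)
  next
    case False
    then have "\<alpha> \<le> 1 / 2" and n: "card V \<ge> 2 powr ((1 / \<alpha>) ^ 20)" using r' by (auto simp: n_def)
    from exists_bounded_degree_switching[OF this] obtain x' :: "'a \<Rightarrow> 'b" and t where
      S: "equiangular_vectors V x' \<alpha>" and t: "real t \<le> (1 / \<alpha>)\<^sup>2"
        "\<And>v. v \<in> V \<Longrightarrow> card (weighted_graph.nb (equiangular_vectors.neg V x' \<alpha>) v) \<le> t"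
      by blast
    interpret S: equiangular_vectors V x' \<alpha> by (rule S)
    show ?thesis
      using S.card_bound_bounded_degree[OF \<open>\<alpha> \<le> 1 / 2\<close> n t(2,1)] by (simp add: n_def r_def)
  qed
  \<comment> \<open>This settles the alternative \<open>n \<le> r\<close>, where the claim reduces
    to \<open>lam \<le> r - 1\<close>.\<close>
  have lam_r: "lam \<le> r - 1"
  proof -
    define b where "b = 1 / \<alpha>"
    have b: "b > 1" using \<alpha>_pos \<alpha>_less by (simp add: b_def)
    have lam: "2 * lam = b - 1" using \<alpha>_pos by (simp add: lam_def b_def field_simps)
    have "1 + b * ln 2 \<le> exp (b * ln 2)" by (rule exp_ge_add_one_self)
    also have "\<dots> = 2 powr b" by (simp add: powr_def)
    also have "\<dots> \<le> 2 powr (b ^ 20)" using b power_increasing[of 1 20 b] by (intro powr_mono) auto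
    also have "\<dots> \<le> r" using r' by (simp add: b_def)
    finally have "1 + b * ln 2 \<le> r" .
    moreover have "b * (1 / 2) \<le> b * ln 2"
      using ln2_ge_two_thirds b by (intro mult_left_mono) auto
    ultimately show ?thesis using lam b by linarith
  qed
  have "lam * n \<le> (1 + lam) * (r - 1)"
    using dich
  proof
    assume "n \<le> r"
    then have "lam * n \<le> lam * r" using lam_pos by simp
    also have "\<dots> \<le> (1 + lam) * (r - 1)" using lam_r by (simp add: algebra_simps)
    finally show ?thesis .
  qed
  then have "n \<le> (1 + 1 / lam) * (r - 1)" using lam_pos by (simp add: field_simps)
  also have "1 / lam = 2 * \<alpha> / (1 - \<alpha>)" by (simp add: lam_def)
  finally show ?thesis by (simp add: n_def r_def)
qed

end

subsection \<open>Lines\<close>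

lemma origin_line_direction:
  assumes "origin_line L"
  obtains u where "u \<in> L" "norm u = 1" "\<And>w. w \<in> L \<Longrightarrow> \<exists>c. w = c *\<^sub>R u"
proof -
  have L: "subspace L" "dim L = 1" using assms by (auto simp: origin_line_def)
  have "\<not> L \<subseteq> {0}" using L(2) dim_eq_0[of L] by simp
  then obtain w where w: "w \<in> L" "w \<noteq> 0" by blast
  define u where "u = inverse (norm w) *\<^sub>R w"
  have u: "u \<in> L" "norm u = 1" using w L(1) by (auto simp: u_def subspace_scale)
  then have "u \<noteq> 0" by auto
  then have "independent {u}" by simp
  then have "L \<subseteq> span {u}" using u L by (intro card_ge_dim_independent) auto
  then show ?thesis using u by (intro that) (auto simp: span_singleton)
qed

text \<open>All angles between the lines have cosine plus or minus \<open>u \<bullet> v\<close>, and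
  the infimum is attained at the sign that makes the cosine nonnegative.\<close>

lemma line_angle_eq:
  assumes u: "u \<in> L" "norm u = 1" "\<And>w. w \<in> L \<Longrightarrow> \<exists>c. w = c *\<^sub>R u"
    and v: "v \<in> M" "norm v = 1" "\<And>w. w \<in> M \<Longrightarrow> \<exists>c. w = c *\<^sub>R v"
    and L: "origin_line L"
  shows "line_angle L M = arccos \<bar>u \<bullet> v\<bar>"
  unfolding line_angle_def
proof (rule cInf_eq_minimum)
  have p: "\<bar>u \<bullet> v\<bar> \<le> 1" using Cauchy_Schwarz_ineq2[of u v] u v by simp
  define s where "s = (if u \<bullet> v < 0 then -1 else 1 :: real)"
  have "vec_angle (s *\<^sub>R u) v = arccos \<bar>u \<bullet> v\<bar>"
    using u v by (auto simp: vec_angle_def s_def)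
  moreover have "s *\<^sub>R u \<in> L" using u L by (simp add: origin_line_def subspace_scale)
  moreover have "s *\<^sub>R u \<noteq> 0" "v \<noteq> 0" using u v by (auto simp: s_def)
  ultimately show "arccos \<bar>u \<bullet> v\<bar> \<in> {vec_angle u v |u v. u \<in> L \<and> v \<in> M \<and> u \<noteq> 0 \<and> v \<noteq> 0}"
    using v(1) by (metis (mono_tags, lifting) mem_Collect_eq)
  fix a assume "a \<in> {vec_angle u v |u v. u \<in> L \<and> v \<in> M \<and> u \<noteq> 0 \<and> v \<noteq> 0}"
  then obtain y z where yz: "y \<in> L" "z \<in> M" "y \<noteq> 0" "z \<noteq> 0" "a = vec_angle y z" by blast
  obtain c d where cd: "y = c *\<^sub>R u" "z = d *\<^sub>R v" using u(3)[OF yz(1)] v(3)[OF yz(2)] by blast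
  define q where "q = (y \<bullet> z) / (norm y * norm z)"
  have "\<bar>q\<bar> = \<bar>u \<bullet> v\<bar>" using yz u v by (simp add: q_def cd abs_mult)
  then have "- 1 \<le> q" "q \<le> \<bar>u \<bullet> v\<bar>" using p by auto
  then show "arccos \<bar>u \<bullet> v\<bar> \<le> a"
    using arccos_le_arccos[of q "\<bar>u \<bullet> v\<bar>"] p by (simp add: yz(5) vec_angle_def q_def)
qed

lemma equiangular_lines_vectors:
  fixes F :: "'a::euclidean_space set set"
  assumes F: "equiangular \<alpha> F" "finite G" "G \<subseteq> F" and \<alpha>: "0 < \<alpha>" "\<alpha> < 1"
  shows "\<exists>x :: 'a set \<Rightarrow> 'a. equiangular_vectors G x \<alpha>"
proof -
  have line: "origin_line L" if "L \<in> G" for L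
    using F that by (auto simp: equiangular_def)
  then have "\<forall>L\<in>G. \<exists>u. u \<in> L \<and> norm u = 1 \<and> (\<forall>w\<in>L. \<exists>c. w = c *\<^sub>R u)"
    by (metis origin_line_direction)
  then obtain x where x: "\<And>L. L \<in> G \<Longrightarrow> x L \<in> L \<and> norm (x L) = 1 \<and> (\<forall>w\<in>L. \<exists>c. w = c *\<^sub>R x L)"
    by metis
  have "equiangular_vectors G x \<alpha>"
  proof
    fix L assume "L \<in> G"
    then show "x L \<bullet> x L = 1" using x by (simp add: dot_square_norm)
  next
    fix L M assume LM: "L \<in> G" "M \<in> G" "L \<noteq> M"
    have "line_angle L M = arccos \<bar>x L \<bullet> x M\<bar>"
      using x[OF LM(1)] x[OF LM(2)] line[OF LM(1)] by (intro line_angle_eq) auto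
    moreover have "line_angle L M = arccos \<alpha>" 
      using F(1) subsetD[OF F(3) LM(1)] subsetD[OF F(3) LM(2)] LM(3) by (simp add: equiangular_def)
    moreover have "\<bar>x L \<bullet> x M\<bar> \<le> 1"
      using Cauchy_Schwarz_ineq2[of "x L" "x M"] x LM by simp
    ultimately show "\<bar>x L \<bullet> x M\<bar> = \<alpha>" using \<alpha> by (simp add: arccos_eq_iff)
  qed (use assms in auto)
  then show ?thesis by blast
qed

theorem theorem3p4:
  fixes \<alpha> :: real and r :: nat and F :: "(real ^ 'n) set set"
  assumes "0 < \<alpha>" and "\<alpha> < 1"
    and "CARD('n) = r"
    and "real r \<ge> 2 powr (1 / \<alpha> ^ 20)"
    and "equiangular \<alpha> F"
  shows "finite F \<and> int (card F) \<le> \<lfloor>(1 + 2 * \<alpha> / (1 - \<alpha>)) * (real r - 1)\<rfloor>"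
proof -
  define B where "B = (1 + 2 * \<alpha> / (1 - \<alpha>)) * (real r - 1)"
  \<comment> \<open>Finite subfamilies come first because \<open>F\<close> is not known to be
    finite; an infinite \<open>F\<close> would contain one with more than \<open>B\<close>
    members.\<close>
  have bound: "real (card G) \<le> B" if G: "finite G" "G \<subseteq> F" for G
  proof -
    obtain x :: "(real ^ 'n) set \<Rightarrow> real ^ 'n" where "equiangular_vectors G x \<alpha>"
      using equiangular_lines_vectors[OF assms(5) G assms(1,2)] by blast
    then interpret equiangular_vectors G x \<alpha> .
    show ?thesis using card_bound assms(3,4) by (simp add: B_def)
  qed
  have "finite F"
  proof (rule ccontr)
    assume "infinite F"
    then obtain G where G: "G \<subseteq> F" "finite G" "card G = nat \<lceil>B\<rceil> + 1"
      using infinite_arbitrarily_large by blast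
    then show False using bound[OF G(2,1)] by linarith
  qed
  with bound[of F] show ?thesis by (simp add: B_def le_floor_iff)
qed

end
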